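(* Let $X$ be a separable metric space and let $K$ be a CW complex. If $X\tau_{cm}K$ (equivalently, $\beta(X)\tau K$), then $X\tau K$.
   Context: $\beta(X)$ is the Čech–Stone compactification of $X$. $X\tau K$ means that every map $f\colon A\to K$ with $A$ closed in $X$ extends to a map $X\to K$. A compact map is a continuous function whose image is contained in a compact subset of the target. $X\tau_{cm}K$ means that every compact map $f\colon A\to K$, $A$ closed in $X$, extends to a compact map $g\colon X\to K$. *)

theory Defs
  imports "HOL-Analysis.Analysis"
begin

section \<open>CW complexes\<close>

definition cell_disc :: "nat \<Rightarrow> (nat \<Rightarrow> real) set" where
  "cell_disc n = {x \<in> topspace (Euclidean_space n). (\<Sum>i<n. (x i)\<^sup>2) \<le> 1}"

definition cell_ball :: "nat \<Rightarrow> (nat \<Rightarrow> real) set" where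
  "cell_ball n = {x \<in> topspace (Euclidean_space n). (\<Sum>i<n. (x i)\<^sup>2) < 1}"

text \<open>
  This is the sphere of dimension \<open>n - 1\<close> bounding \<open>cell_disc n\<close>; it is empty for \<open>n = 0\<close>.
\<close>
definition cell_sphere :: "nat \<Rightarrow> (nat \<Rightarrow> real) set" where
  "cell_sphere n = {x \<in> topspace (Euclidean_space n). (\<Sum>i<n. (x i)\<^sup>2) = 1}"

text \<open>
  \<open>E\<close> is the set of open cells, \<open>dm e\<close> the dimension of the cell \<open>e\<close> and \<open>\<Phi> e\<close> its
  characteristic map. The last two conjuncts are J. H. C. Whitehead's conditions C (closure
  finiteness) and W (weak topology). No bound on the number or the dimension of the cells is
  imposed, and the empty complex is allowed.
\<close>
definition CW_structure ::
  "'b topology \<Rightarrow> 'b set set \<Rightarrow> ('b set \<Rightarrow> nat) \<Rightarrow> ('b set \<Rightarrow> (nat \<Rightarrow> real) \<Rightarrow> 'b) \<Rightarrow> bool" where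
  "CW_structure K E dm \<Phi> \<longleftrightarrow>
     Hausdorff_space K \<and>
     \<Union>E = topspace K \<and> pairwise disjnt E \<and>
     (\<forall>e\<in>E. continuous_map (subtopology (Euclidean_space (dm e)) (cell_disc (dm e))) K (\<Phi> e) \<and>
             homeomorphic_map (subtopology (Euclidean_space (dm e)) (cell_ball (dm e)))
                              (subtopology K e) (\<Phi> e)) \<and>
     (\<forall>e\<in>E. \<exists>F. finite F \<and> F \<subseteq> {c \<in> E. dm c < dm e} \<and> \<Phi> e ` cell_sphere (dm e) \<subseteq> \<Union>F) \<and>
     (\<forall>A. A \<subseteq> topspace K \<longrightarrow> (closedin K A \<longleftrightarrow> (\<forall>e\<in>E. closedin K (A \<inter> K closure_of e))))"

definition CW_complex :: "'b topology \<Rightarrow> bool" where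
  "CW_complex K \<longleftrightarrow> (\<exists>E dm \<Phi>. CW_structure K E dm \<Phi>)"


section \<open>Extension properties\<close>

text \<open>\<open>map_extension X K\<close> is the relation \<open>X \<tau> K\<close>.\<close>
definition map_extension :: "'a topology \<Rightarrow> 'b topology \<Rightarrow> bool" where
  "map_extension X K \<longleftrightarrow>
     (\<forall>A f. closedin X A \<and> continuous_map (subtopology X A) K f \<longrightarrow>
            (\<exists>g. continuous_map X K g \<and> (\<forall>x\<in>A. g x = f x)))"

definition compact_map :: "'a topology \<Rightarrow> 'b topology \<Rightarrow> ('a \<Rightarrow> 'b) \<Rightarrow> bool" where
  "compact_map X Y f \<longleftrightarrow> continuous_map X Y f \<and> (\<exists>C. compactin Y C \<and> f ` topspace X \<subseteq> C)"

text \<open>\<open>compact_map_extension X K\<close> is the relation \<open>X \<tau>\<^sub>c\<^sub>m K\<close>.\<close>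
definition compact_map_extension :: "'a topology \<Rightarrow> 'b topology \<Rightarrow> bool" where
  "compact_map_extension X K \<longleftrightarrow>
     (\<forall>A f. closedin X A \<and> compact_map (subtopology X A) K f \<longrightarrow>
            (\<exists>g. compact_map X K g \<and> (\<forall>x\<in>A. g x = f x)))"


section \<open>Stone-Cech compactification\<close>

text \<open>
  The space is the closure of the image of \<open>X\<close> in the cube indexed by all maps from \<open>X\<close> to the
  unit interval. The maps are taken extensional, so that each one occurs exactly once as an index.
\<close>
definition unit_maps :: "'a topology \<Rightarrow> ('a \<Rightarrow> real) set" where
  "unit_maps X = {h \<in> extensional (topspace X). continuous_map X (top_of_set {0..1}) h}"

definition unit_cube :: "'a topology \<Rightarrow> (('a \<Rightarrow> real) \<Rightarrow> real) topology" where
  "unit_cube X = product_topology (\<lambda>_. top_of_set {0..1}) (unit_maps X)"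

definition stone_cech_map :: "'a topology \<Rightarrow> 'a \<Rightarrow> ('a \<Rightarrow> real) \<Rightarrow> real" where
  "stone_cech_map X x = (\<lambda>h\<in>unit_maps X. h x)"

definition stone_cech :: "'a topology \<Rightarrow> (('a \<Rightarrow> real) \<Rightarrow> real) topology" where
  "stone_cech X =
     subtopology (unit_cube X) (unit_cube X closure_of (stone_cech_map X ` topspace X))"

lemma compact_Hausdorff_stone_cech: "compact_space (stone_cech X)" "Hausdorff_space (stone_cech X)"
proof -
  have "compact_space (unit_cube X)"
    by (auto simp: unit_cube_def compact_space_product_topology compact_space_subtopology)
  then show "compact_space (stone_cech X)"
    by (simp add: stone_cech_def closedin_compact_space compact_space_subtopology)
  have "Hausdorff_space (unit_cube X)"
    by (simp add: unit_cube_def Hausdorff_space_product_topology Hausdorff_space_subtopology)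
  then show "Hausdorff_space (stone_cech X)"
    by (simp add: stone_cech_def Hausdorff_space_subtopology)
qed

lemma continuous_map_stone_cech_map: "continuous_map X (stone_cech X) (stone_cech_map X)"
proof -
  have cm: "continuous_map X (unit_cube X) (stone_cech_map X)"
    unfolding unit_cube_def continuous_map_componentwise
  proof (intro conjI ballI)
    fix h assume "h \<in> unit_maps X"
    then show "continuous_map X (top_of_set {0..1}) (\<lambda>x. stone_cech_map X x h)"
      by (simp add: stone_cech_map_def unit_maps_def)
  qed (auto simp: stone_cech_map_def)
  then have "stone_cech_map X ` topspace X \<subseteq> topspace (unit_cube X)"
    by (simp add: continuous_map_image_subset_topspace)
  then show ?thesis
    using cm closure_of_subset
    by (fastforce simp: stone_cech_def continuous_map_in_subtopology)
qed

lemma dense_stone_cech_map: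
  "stone_cech X closure_of (stone_cech_map X ` topspace X) = topspace (stone_cech X)"
proof -
  let ?I = "stone_cech_map X ` topspace X"
  have "?I \<subseteq> topspace (stone_cech X)"
    by (simp add: continuous_map_image_subset_topspace continuous_map_stone_cech_map)
  then have "?I \<subseteq> unit_cube X closure_of ?I"
    by (simp add: stone_cech_def)
  then show ?thesis
    by (simp add: stone_cech_def closure_of_subtopology Int_absorb1 Int_absorb2
        closure_of_subset_topspace)
qed

end

theory Submission
  imports Defs
begin

text \<open>
  A compact map into a Hausdorff space on a closed subset \<open>A\<close> of a normal space \<open>X\<close> extends to a closed
  subset of \<open>\<beta>(X)\<close> containing \<open>A\<close>, which gives \<open>X \<tau>\<^sub>c\<^sub>m K\<close> from \<open>\<beta>(X) \<tau> K\<close>. Conversely, a map on a closed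
  subset of \<open>\<beta>(X)\<close> has its image in a finite subcomplex of \<open>K\<close>, and finite subcomplexes are neighbourhood
  extensors for compact Hausdorff spaces (by induction on the number of cells). Hence it extends to a
  closed neighbourhood \<open>N\<close>; the restriction to \<open>N \<inter> X\<close> extends to a compact map on \<open>X\<close>, hence to a map on
  \<open>\<beta>(X)\<close>, which agrees with the given one by density of \<open>X\<close>.

  For the last claim, a map from a metric space to \<open>K\<close> meets locally only finitely many cells, because
  compact sets do. So \<open>X\<close> is exhausted by closed sets \<open>X n\<close>, each in the interior of the next, such that
  \<open>f\<close> is a compact map on every \<open>A \<inter> X n\<close>, and one extends over the sets \<open>X n\<close> one after the other.
\<close>

section \<open>Topological preliminaries\<close>

lemma closedin_equalizers:
  assumes "Hausdorff_space Y"
    and "\<And>j. j \<in> J \<Longrightarrow> continuous_map X Y (F j)" "\<And>j. j \<in> J \<Longrightarrow> continuous_map X Y (G j)"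
  shows "closedin X {v \<in> topspace X. \<forall>j\<in>J. F j v = G j v}"
proof -
  have "{v \<in> topspace X. \<forall>j\<in>J. F j v = G j v}
      = \<Inter>(insert (topspace X) ((\<lambda>j. {v \<in> topspace X. F j v = G j v}) ` J))"
    by auto
  moreover have "closedin X \<dots>"
    by (intro closedin_Inter) (auto intro: closedin_continuous_maps_eq assms)
  ultimately show ?thesis
    by simp
qed

text \<open>Projection along the compact factor \<open>P\<close> is a closed map, so
  \<open>g\<close> pulls a closed set back to the projection of a closed subset of \<open>T\<close>.
  The lemma builds continuous maps from closed relations even where the witness \<open>p\<close> is
  not determined by \<open>z\<close>.\<close>

lemma continuous_map_of_closed_relation:
  assumes P: "compact_space P" and T: "closedin (prod_topology Z P) T"
    and h: "continuous_map (subtopology (prod_topology Z P) T) K h"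
    and single: "\<And>z p p'. (z, p) \<in> T \<Longrightarrow> (z, p') \<in> T \<Longrightarrow> h (z, p) = h (z, p')"
  obtains g where "closedin Z (fst ` T)" "continuous_map (subtopology Z (fst ` T)) K g"
    "\<And>z p. (z, p) \<in> T \<Longrightarrow> g z = h (z, p)"
proof -
  define g where "g z = h (z, SOME p. (z, p) \<in> T)" for z
  have g: "g z = h (z, p)" if "(z, p) \<in> T" for z p
    unfolding g_def by (rule single[OF _ that]) (use that in \<open>rule someI\<close>)
  have cm: "closedin Z (fst ` S)" if "closedin (prod_topology Z P) S" for S
    using Abstract_Topological_Spaces.closed_map_fst[OF P] that unfolding closed_map_def by blast
  have clT: "closedin Z (fst ` T)"
    by (rule cm[OF T])
  have Tsub: "T \<subseteq> topspace Z \<times> topspace P"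
    using closedin_subset[OF T] by simp
  have "continuous_map (subtopology Z (fst ` T)) K g"
    unfolding continuous_map_closedin
  proof (intro conjI allI impI)
    have "h v \<in> topspace K" if "v \<in> T" for v
      using continuous_map_image_subset_topspace[OF h] that Tsub by auto
    then show "g \<in> topspace (subtopology Z (fst ` T)) \<rightarrow> topspace K"
      using g by fastforce
    fix C assume "closedin K C"
    from closedin_continuous_map_preimage[OF h this] 
    have "closedin (subtopology (prod_topology Z P) T) {v \<in> T. h v \<in> C}"
      using Tsub by (simp add: Int_absorb1 Collect_conj_eq)
    then have "closedin (prod_topology Z P) {v \<in> T. h v \<in> C}"
      using T closedin_trans_full by blast
    then have "closedin Z (fst ` {v \<in> T. h v \<in> C})"
      by (rule cm)
    moreover have "{z \<in> topspace (subtopology Z (fst ` T)). g z \<in> C} = fst ` {v \<in> T. h v \<in> C}"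
      using Tsub g by force
    ultimately show "closedin (subtopology Z (fst ` T)) {z \<in> topspace (subtopology Z (fst ` T)). g z \<in> C}"
      by (metis (no_types, lifting) clT closedin_closed_subtopology image_mono mem_Collect_eq subsetI)
  qed
  then show ?thesis
    using that g clT by blast
qed

lemma continuous_map_closed_Un:
  assumes S: "closedin X S" and T: "closedin X T"
    and f: "continuous_map (subtopology X S) Y f" and g: "continuous_map (subtopology X T) Y g"
    and eq: "\<And>x. x \<in> S \<Longrightarrow> x \<in> T \<Longrightarrow> f x = g x"
  shows "continuous_map (subtopology X (S \<union> T)) Y (\<lambda>x. if x \<in> S then f x else g x)"
proof (rule pasting_lemma_closed[where I = "UNIV :: bool set" and T = "\<lambda>b. if b then S else T"
      and f = "\<lambda>b. if b then f else g"])
  show "closedin (subtopology X (S \<union> T)) (if i then S else T)" for i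
    using S T by (auto intro: closedin_subset_topspace)
  show "continuous_map (subtopology (subtopology X (S \<union> T)) (if i then S else T)) Y (if i then f else g)" for i
    using f g by (auto simp: subtopology_subtopology Int_absorb1)
qed (use eq in \<open>auto split: if_splits\<close>)

lemma Hausdorff_closed_nbhd:
  assumes "compact_space Z" "Hausdorff_space Z" "closedin Z B" "closedin Z D" "B \<inter> D = {}"
  obtains N where "closedin Z N" "B \<subseteq> Z interior_of N" "N \<inter> D = {}"
proof -
  have "normal_space Z"
    using assms compact_Hausdorff_or_regular_imp_normal_space by blast
  moreover have "openin Z (topspace Z - D)" "B \<subseteq> topspace Z - D"
    using assms closedin_subset by (fastforce)+
  ultimately obtain V where V: "openin Z V" "B \<subseteq> V" "Z closure_of V \<subseteq> topspace Z - D"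
    using assms(3) unfolding normal_space_alt by meson
  show ?thesis
  proof
    show "closedin Z (Z closure_of V)" by simp
    show "B \<subseteq> Z interior_of (Z closure_of V)"
      using V by (meson closure_of_subset interior_of_maximal openin_subset subset_trans)
    show "Z closure_of V \<inter> D = {}"
      using V by blast
  qed
qed

text \<open>The hypotheses make \<open>g\<close> constant on the fibres of \<open>\<Phi>\<close>, so
  it descends to the image. The relation \<open>k = \<Phi> x\<close> is closed in the product of
  \<open>K\<close> with the compact \<open>D\<close>, which makes the descended function continuous;
  it is then glued with 0 on \<open>L\<close>.\<close>

lemma map_of_attached_disc:
  assumes K: "Hausdorff_space K" and D: "compact_space D"
    and \<Phi>: "continuous_map D K \<Phi>" and L: "closedin K L"
    and g: "continuous_map D euclideanreal g"
    and inj: "\<And>x x'. x \<in> topspace D \<Longrightarrow> x' \<in> topspace D \<Longrightarrow> \<Phi> x = \<Phi> x' \<Longrightarrow> \<Phi> x \<notin> L \<Longrightarrow> x = x'"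
    and zero: "\<And>x. x \<in> topspace D \<Longrightarrow> \<Phi> x \<in> L \<Longrightarrow> g x = (0::real)"
  obtains q where "continuous_map (subtopology K (L \<union> \<Phi> ` topspace D)) euclideanreal q"
    "\<And>k. k \<in> L \<Longrightarrow> q k = 0" "\<And>x. x \<in> topspace D \<Longrightarrow> q (\<Phi> x) = g x"
proof -
  define T where "T = {v \<in> topspace (prod_topology K D). fst v = \<Phi> (snd v)}"
  have T: "closedin (prod_topology K D) T"
    unfolding T_def using continuous_map_compose[OF continuous_map_snd \<Phi>]
    by (intro closedin_continuous_maps_eq[OF K] continuous_intros) (simp add: o_def)
  have h: "continuous_map (subtopology (prod_topology K D) T) euclideanreal (\<lambda>v. g (snd v))"
    using continuous_map_compose[OF continuous_map_subtopology_snd g] by (simp add: o_def)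
  have mem: "(\<Phi> x, x) \<in> T" if "x \<in> topspace D" for x
    using that continuous_map_image_subset_topspace[OF \<Phi>] by (auto simp: T_def)
  have single: "g (snd (k, x)) = g (snd (k, x'))" if "(k, x) \<in> T" "(k, x') \<in> T" for k x x'
  proof -
    have x: "x \<in> topspace D" "x' \<in> topspace D" "k = \<Phi> x" "\<Phi> x = \<Phi> x'"
      using that by (auto simp: T_def)
    show ?thesis
    proof (cases "k \<in> L")
      case True
      then show ?thesis
        using zero[of x] zero[of x'] x by simp
    next
      case False
      then show ?thesis
        using inj[of x x'] x by simp
    qed
  qed
  obtain q0 where q0: "closedin K (fst ` T)" "continuous_map (subtopology K (fst ` T)) euclideanreal q0"
    "\<And>k x. (k, x) \<in> T \<Longrightarrow> q0 k = g (snd (k, x))"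
    using continuous_map_of_closed_relation[OF D T h single] by blast
  have fT: "fst ` T = \<Phi> ` topspace D"
    using mem by (force simp: T_def)
  let ?q = "\<lambda>k. if k \<in> L then 0 else q0 k"
  show ?thesis
  proof
    have "0 = q0 k" if "k \<in> L" "k \<in> fst ` T" for k
      using that q0(3) zero by (force simp: T_def)
    then have "continuous_map (subtopology K (L \<union> fst ` T)) euclideanreal ?q"
      by (intro continuous_map_closed_Un L q0) auto
    then show "continuous_map (subtopology K (L \<union> \<Phi> ` topspace D)) euclideanreal ?q"
      by (simp add: fT)
    show "?q (\<Phi> x) = g x" if "x \<in> topspace D" for x
      using q0(3)[OF mem[OF that]] zero[OF that] by auto
  qed auto
qed

section \<open>Discs\<close>

definition radius :: "nat \<Rightarrow> (nat \<Rightarrow> real) \<Rightarrow> real" where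
  "radius n x = sqrt (\<Sum>i<n. (x i)\<^sup>2)"

abbreviation disc_top :: "nat \<Rightarrow> (nat \<Rightarrow> real) topology" where
  "disc_top n \<equiv> subtopology (Euclidean_space n) (cell_disc n)"

lemma radius_nonneg [simp]: "0 \<le> radius n x"
  by (simp add: radius_def sum_nonneg)

lemma radius_cong: "(\<And>i. i < n \<Longrightarrow> f i = g i) \<Longrightarrow> radius n f = radius n g"
  by (simp add: radius_def)

lemma radius_scale: "radius n (\<lambda>i. c * x i) = \<bar>c\<bar> * radius n x"
  by (simp add: radius_def power_mult_distrib real_sqrt_mult flip: sum_distrib_left)

lemma topspace_Int_cell_disc [simp]: "topspace (Euclidean_space n) \<inter> cell_disc n = cell_disc n"
  by (auto simp: cell_disc_def)

lemma topspace_disc: "topspace (disc_top n) = cell_disc n"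
  by simp

lemma cell_radius:
  "x \<in> cell_disc n \<longleftrightarrow> (\<forall>i\<ge>n. x i = 0) \<and> radius n x \<le> 1"
  "x \<in> cell_ball n \<longleftrightarrow> (\<forall>i\<ge>n. x i = 0) \<and> radius n x < 1"
  "x \<in> cell_sphere n \<longleftrightarrow> (\<forall>i\<ge>n. x i = 0) \<and> radius n x = 1"
  unfolding cell_disc_def cell_ball_def cell_sphere_def radius_def topspace_Euclidean_space
    real_sqrt_le_1_iff real_sqrt_lt_1_iff real_sqrt_eq_1_iff by blast+

lemma cell_disc_eq: "cell_disc n = cell_ball n \<union> cell_sphere n"
  by (auto simp: cell_radius)

lemma continuous_map_disc_coord [continuous_intros]:
  "continuous_map (disc_top n) euclideanreal (\<lambda>x. x i)"
  unfolding Euclidean_space_def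
  by (intro continuous_map_from_subtopology continuous_map_product_projection) auto

lemma continuous_map_radius:
  assumes "\<And>i. i < n \<Longrightarrow> continuous_map X euclideanreal (\<lambda>z. f z i)"
  shows "continuous_map X euclideanreal (\<lambda>z. radius n (f z))"
  unfolding radius_def by (intro continuous_intros assms) auto

lemma compact_space_disc: "compact_space (disc_top n)"
proof -
  \<comment> \<open>The disc is a closed subset of this product of intervals, which is compact by
    Tychonoff's theorem.\<close>
  let ?C = "PiE UNIV (\<lambda>i::nat. {-1..1::real})"
  have sub: "cell_disc n \<subseteq> ?C"
  proof
    fix x assume x: "x \<in> cell_disc n"
    have "\<bar>x i\<bar> \<le> 1" for i
    proof (cases "i < n")
      case True
      then have "(x i)\<^sup>2 \<le> (\<Sum>i<n. (x i)\<^sup>2)"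
        by (intro member_le_sum) auto
      then have "(x i)\<^sup>2 \<le> 1"
        using x by (simp add: cell_disc_def)
      then show ?thesis
        by (simp add: abs_square_le_1)
    qed (use x in \<open>simp add: cell_radius\<close>)
    then show "x \<in> ?C"
      by (force simp: abs_le_iff)
  qed
  have C: "compactin (powertop_real UNIV) ?C"
    by (subst compactin_PiE) (auto simp: compactin_euclidean_iff)
  have "closedin (Euclidean_space n) {x \<in> topspace (Euclidean_space n). (\<Sum>i<n. (x i)\<^sup>2) \<in> {..1}}"
    unfolding Euclidean_space_def
    by (intro closedin_continuous_map_preimage[where Y = euclideanreal] continuous_intros
          continuous_map_from_subtopology continuous_map_product_projection) auto
  then have "closedin (powertop_real UNIV) (cell_disc n)"
    using closedin_Euclidean_space[of n]
    by (simp add: cell_disc_def Euclidean_space_def closedin_trans_full)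
  then have "compactin (powertop_real UNIV) (cell_disc n)"
    using closed_compactin[OF C sub] by blast
  then show ?thesis
    using sub by (auto simp: Euclidean_space_def subtopology_subtopology compact_space_subtopology
        Int_absorb1 cell_disc_def topspace_Euclidean_space Int_def
        intro!: compact_space_subtopology elim!: back_subst[of "compactin _"])
qed

text \<open>
  Radial expansion by the factor \<open>1 + 4 * t\<close>, cut off at the unit sphere; at \<open>t = 1\<close> it sends every
  point of radius at least \<open>1 / 4\<close> to the sphere.
\<close>
definition push :: "nat \<Rightarrow> real \<Rightarrow> (nat \<Rightarrow> real) \<Rightarrow> nat \<Rightarrow> real" where
  "push n t x i = (1 + 4 * t) / max 1 ((1 + 4 * t) * radius n x) * x i"

lemma radius_push:
  assumes "0 \<le> t"
  shows "radius n (push n t x) = min 1 ((1 + 4 * t) * radius n x)"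
proof -
  have "radius n (push n t x) = \<bar>(1 + 4 * t) / max 1 ((1 + 4 * t) * radius n x)\<bar> * radius n x"
    unfolding push_def[abs_def] by (rule radius_scale)
  also have "\<dots> = (1 + 4 * t) * radius n x / max 1 ((1 + 4 * t) * radius n x)"
    using assms radius_nonneg[of n x] by (subst abs_of_nonneg) auto
  also have "\<dots> = min 1 ((1 + 4 * t) * radius n x)"
    by (auto simp: max_def min_def)
  finally show ?thesis .
qed

lemma push_in_disc:
  assumes "x \<in> cell_disc n" "0 \<le> t"
  shows "push n t x \<in> cell_disc n"
  using assms by (auto simp: cell_radius radius_push push_def)

lemma push_0: "x \<in> cell_disc n \<Longrightarrow> push n 0 x = x"
  by (auto simp: push_def cell_radius max_def fun_eq_iff)

lemma push_sphere: "x \<in> cell_sphere n \<Longrightarrow> 0 \<le> t \<Longrightarrow> push n t x = x"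
  by (auto simp: push_def cell_radius max_def fun_eq_iff)

lemma push_1: "x \<in> cell_disc n \<Longrightarrow> 1 / 4 \<le> radius n x \<Longrightarrow> push n 1 x \<in> cell_sphere n"
  by (auto simp: cell_radius radius_push push_def)

lemma continuous_map_push:
  assumes t: "continuous_map X euclideanreal t" "\<And>v. v \<in> topspace X \<Longrightarrow> 0 \<le> t v"
    and x: "continuous_map X (disc_top n) x"
  shows "continuous_map X (disc_top n) (\<lambda>v. push n (t v) (x v))"
proof -
  have c: "continuous_map X euclideanreal (\<lambda>v. x v i)" for i
    using continuous_map_compose[OF x continuous_map_disc_coord] by (simp add: o_def)
  have mem: "x v \<in> cell_disc n" if "v \<in> topspace X" for v
    using x that by (auto simp: continuous_map_def Pi_iff)
  \<comment> \<open>The zero tail is written out so that the coordinatewise continuity criterion for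
    \<open>Euclidean_space\<close> applies.\<close>
  have "push n (t v) (x v) = (\<lambda>i. if i < n then push n (t v) (x v) i else 0)" if "v \<in> topspace X" for v
    using push_in_disc[OF mem[OF that] t(2)[OF that]] by (auto simp: cell_radius fun_eq_iff)
  moreover have "continuous_map X (Euclidean_space n) (\<lambda>v i. if i < n then push n (t v) (x v) i else 0)"
    unfolding continuous_map_componentwise_Euclidean_space push_def
    by (intro allI impI continuous_intros t c continuous_map_radius) (auto simp: max_def)
  ultimately show ?thesis
    using mem t(2) push_in_disc unfolding continuous_map_in_subtopology
    by (auto intro: continuous_map_eq)
qed

section \<open>Attaching a cell to a neighbourhood extensor\<close>

text \<open>An absolute neighbourhood extensor, but relative to a single test space
  \<open>Z\<close>, because a definition cannot quantify over types. The neighbourhood is closed so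
  that its preimage under a map into \<open>Z\<close> is closed as well.\<close>

definition nbhd_extensor :: "'z topology \<Rightarrow> 'b topology \<Rightarrow> 'b set \<Rightarrow> bool" where
  "nbhd_extensor Z K L \<longleftrightarrow>
     (\<forall>B f. closedin Z B \<and> continuous_map (subtopology Z B) (subtopology K L) f \<longrightarrow>
        (\<exists>N g. closedin Z N \<and> B \<subseteq> Z interior_of N \<and>
               continuous_map (subtopology Z N) (subtopology K L) g \<and> (\<forall>x\<in>B. g x = f x)))"

text \<open>Such a family maps \<open>L\<close> injectively into a finite-dimensional real space.
  Its finiteness allows distances between coordinate vectors to be written as finite sums.\<close>

definition separating :: "'b topology \<Rightarrow> 'b set \<Rightarrow> ('b \<Rightarrow> real) set \<Rightarrow> bool" where
  "separating K L Q \<longleftrightarrow>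
     finite Q \<and> (\<forall>q\<in>Q. continuous_map (subtopology K L) euclideanreal q) \<and>
     (\<forall>k\<in>L. \<forall>k'\<in>L. (\<forall>q\<in>Q. q k = q k') \<longrightarrow> k = k')"

lemma nbhd_extensor_empty: "nbhd_extensor Z K {}"
  unfolding nbhd_extensor_def
proof (intro allI impI, elim conjE)
  fix B f assume "closedin Z B" "continuous_map (subtopology Z B) (subtopology K {}) f"
  then have "B = {}"
    using closedin_subset by (fastforce simp: continuous_map_def Pi_iff)
  then show "\<exists>N g. closedin Z N \<and> B \<subseteq> Z interior_of N \<and>
               continuous_map (subtopology Z N) (subtopology K {}) g \<and> (\<forall>x\<in>B. g x = f x)"
    by (intro exI[of _ "{}"]) auto
qed

text \<open>The cell is attached inside a fixed ambient space, so that \<open>L'\<close> below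
  carries the subspace topology and no adjunction space has to be formed.\<close>

locale cell_attachment =
  fixes K :: "'b topology" and L :: "'b set" and n :: nat and \<Phi> :: "(nat \<Rightarrow> real) \<Rightarrow> 'b"
  assumes K: "Hausdorff_space K" and L: "compactin K L"
    and \<Phi>: "continuous_map (disc_top n) K \<Phi>"
    and inj: "inj_on \<Phi> (cell_ball n)"
    and sphere: "\<Phi> ` cell_sphere n \<subseteq> L" and ball: "\<Phi> ` cell_ball n \<inter> L = {}"
begin

definition L' :: "'b set" where "L' = L \<union> \<Phi> ` cell_disc n"

lemma compactin_L': "compactin K L'"
proof -
  have "compactin K (\<Phi> ` cell_disc n)"
    using image_compactin[OF _ \<Phi>] compact_space_disc by (metis compact_space_def topspace_disc)
  then show ?thesis
    using L by (simp add: L'_def compactin_Un)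
qed

lemma \<Phi>_in_L: "x \<in> cell_disc n \<Longrightarrow> \<Phi> x \<in> L \<longleftrightarrow> radius n x = 1"
proof (cases "x \<in> cell_sphere n")
  case False
  moreover assume "x \<in> cell_disc n"
  ultimately have "x \<in> cell_ball n"
    by (simp add: cell_disc_eq)
  then show ?thesis
    using ball cell_radius(2)[of x n] by auto
qed (use sphere cell_radius(3)[of x n] in auto)

lemma \<Phi>_in_L': "x \<in> cell_disc n \<Longrightarrow> \<Phi> x \<in> L'"
  by (simp add: L'_def)

lemma \<Phi>_inj:
  assumes "x \<in> cell_disc n" "x' \<in> cell_disc n" "\<Phi> x = \<Phi> x'" "\<Phi> x \<notin> L"
  shows "x = x'"
proof -
  have "x \<in> cell_ball n" "x' \<in> cell_ball n"
    using assms sphere by (auto simp: cell_disc_eq)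
  with assms show ?thesis
    using inj by (simp add: inj_on_def)
qed

text \<open>The functions \<open>1 - radius n x\<close> and \<open>(1 - radius n x) * x i\<close>
  vanish on the sphere and therefore descend to \<open>L'\<close> with value 0 on \<open>L\<close>.
  On the open cell \<open>\<tau>\<close> is positive and \<open>y i\<close> divided by
  \<open>\<tau>\<close> recovers \<open>x i\<close>.\<close>

lemma disc_coordinates:
  obtains \<tau> y where "continuous_map (subtopology K L') euclideanreal \<tau>"
    "\<And>i. i < n \<Longrightarrow> continuous_map (subtopology K L') euclideanreal (y i)"
    "\<And>k. k \<in> L \<Longrightarrow> \<tau> k = 0"
    "\<And>x. x \<in> cell_disc n \<Longrightarrow> \<tau> (\<Phi> x) = 1 - radius n x"
    "\<And>x i. x \<in> cell_disc n \<Longrightarrow> i < n \<Longrightarrow> y i (\<Phi> x) = (1 - radius n x) * x i"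
proof -
  have r: "continuous_map (disc_top n) euclideanreal (\<lambda>x. radius n x)"
    by (intro continuous_map_radius continuous_map_disc_coord)
  have *: "\<exists>q. continuous_map (subtopology K L') euclideanreal q \<and> (\<forall>k\<in>L. q k = 0) \<and>
      (\<forall>x\<in>cell_disc n. q (\<Phi> x) = (1 - radius n x) * h x)"
    if h: "continuous_map (disc_top n) euclideanreal h" for h
  proof -
    have "continuous_map (disc_top n) euclideanreal (\<lambda>x. (1 - radius n x) * h x)"
      by (intro continuous_intros r h) auto
    from map_of_attached_disc[OF K compact_space_disc \<Phi> compactin_imp_closedin[OF K L] this]
    show ?thesis
      using \<Phi>_inj \<Phi>_in_L unfolding topspace_disc L'_def[symmetric]
      by (smt (verit, best) mult_eq_0_iff)
  qed
  obtain \<tau> where "continuous_map (subtopology K L') euclideanreal \<tau>" "\<forall>k\<in>L. \<tau> k = 0"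
      "\<forall>x\<in>cell_disc n. \<tau> (\<Phi> x) = (1 - radius n x) * 1"
    using *[of "\<lambda>_. 1"] by auto
  moreover obtain y where "\<And>i. continuous_map (subtopology K L') euclideanreal (y i)"
      "\<And>i. \<forall>x\<in>cell_disc n. y i (\<Phi> x) = (1 - radius n x) * x i"
    using *[OF continuous_map_disc_coord] by metis
  ultimately show ?thesis
    using that[of \<tau> y] by auto
qed

text \<open>Tietze's theorem carries the functions in \<open>Q\<close> over to \<open>L'\<close>,
  where they still separate the points of \<open>L\<close>. The remaining pairs are separated by
  \<open>\<tau>\<close>, which within \<open>L'\<close> vanishes only on \<open>L\<close>, and by
  the \<open>y i\<close>, which together with \<open>\<tau>\<close> determine the disc
  point.\<close>

lemma separating_attach:
  assumes Q: "separating K L Q"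
  obtains Q' \<tau> y where "separating K L' Q'" "\<tau> \<in> Q'"
    "\<And>i. i < n \<Longrightarrow> continuous_map (subtopology K L') euclideanreal (y i)"
    "\<And>k. k \<in> L \<Longrightarrow> \<tau> k = 0"
    "\<And>x. x \<in> cell_disc n \<Longrightarrow> \<tau> (\<Phi> x) = 1 - radius n x"
    "\<And>x i. x \<in> cell_disc n \<Longrightarrow> i < n \<Longrightarrow> y i (\<Phi> x) = (1 - radius n x) * x i"
proof -
  obtain \<tau> y where \<tau>: "continuous_map (subtopology K L') euclideanreal \<tau>"
    and y: "\<And>i. i < n \<Longrightarrow> continuous_map (subtopology K L') euclideanreal (y i)"
    and \<tau>0: "\<And>k. k \<in> L \<Longrightarrow> \<tau> k = 0"
    and \<tau>\<Phi>: "\<And>x. x \<in> cell_disc n \<Longrightarrow> \<tau> (\<Phi> x) = 1 - radius n x"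
    and y\<Phi>: "\<And>x i. x \<in> cell_disc n \<Longrightarrow> i < n \<Longrightarrow> y i (\<Phi> x) = (1 - radius n x) * x i"
    using disc_coordinates by metis
  have LL': "L \<subseteq> L'" by (auto simp: L'_def)
  have nL': "normal_space (subtopology K L')"
    using K compactin_L' by (simp add: Hausdorff_space_subtopology compact_Hausdorff_or_regular_imp_normal_space compact_space_subtopology)
  have cL: "closedin (subtopology K L') L"
    using K L LL' by (simp add: closedin_subset_topspace compactin_imp_closedin)
  have "\<exists>q'. continuous_map (subtopology K L') euclideanreal q' \<and> (\<forall>k\<in>L. q' k = q k)" if "q \<in> Q" for q
  proof -
    have "continuous_map (subtopology (subtopology K L') L) euclideanreal q"
      using Q that LL' by (simp add: separating_def subtopology_subtopology Int_absorb1)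
    then show ?thesis
      using Tietze_extension_realinterval[OF nL' cL, of UNIV q] by (metis UNIV_not_empty is_interval_univ subset_UNIV)
  qed
  then obtain e where e: "\<And>q. q \<in> Q \<Longrightarrow> continuous_map (subtopology K L') euclideanreal (e q)"
      "\<And>q k. q \<in> Q \<Longrightarrow> k \<in> L \<Longrightarrow> e q k = q k"
    by metis
  let ?Q = "insert \<tau> (y ` {..<n} \<union> e ` Q)"
  have "k = k'" if k: "k \<in> L'" "k' \<in> L'" and eq: "\<And>q. q \<in> ?Q \<Longrightarrow> q k = q k'" for k k'
  proof (cases "k \<in> L \<and> k' \<in> L")
    case True
    then show ?thesis
      using eq e(2) Q unfolding separating_def by (metis UnI2 imageI insertI2)
  next
    case False
    have off: "\<tau> v > 0 \<and> (\<exists>x \<in> cell_disc n. v = \<Phi> x)" if "v \<in> L'" "v \<notin> L" for v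
      using that \<tau>\<Phi> \<Phi>_in_L by (force simp: L'_def cell_radius less_le)
    have "\<tau> k = \<tau> k'"
      using eq by simp
    then have "k \<notin> L" "k' \<notin> L"
      using False off[OF k(1)] off[OF k(2)] \<tau>0 by fastforce+
    then obtain x x' where x: "x \<in> cell_disc n" "k = \<Phi> x" "x' \<in> cell_disc n" "k' = \<Phi> x'"
      and pos: "\<tau> k > 0"
      using off k by meson
    have r: "1 - radius n x = \<tau> k" "1 - radius n x' = \<tau> k"
      using x \<tau>\<Phi> \<open>\<tau> k = \<tau> k'\<close> by auto
    have "x = x'"
    proof
      fix i show "x i = x' i"
      proof (cases "i < n")
        case True
        then have "\<tau> k * x i = \<tau> k * x' i"
          using eq[of "y i"] y\<Phi>[of x i] y\<Phi>[of x' i] x r by auto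
        then show ?thesis
          using pos by simp
      qed (use x in \<open>auto simp: cell_radius\<close>)
    qed
    then show ?thesis
      using x by auto
  qed
  moreover have "continuous_map (subtopology K L') euclideanreal q" if "q \<in> ?Q" for q
    using that \<tau> y e(1) by auto
  moreover have "finite ?Q"
    using Q by (simp add: separating_def)
  ultimately have "separating K L' ?Q"
    unfolding separating_def by metis
  then show ?thesis
    using that[of ?Q \<tau> y] y \<tau>0 \<tau>\<Phi> y\<Phi> by blast
qed

text \<open>
  Tietze's theorem extends the coordinates \<open>\<tau> \<circ> f\<close>, \<open>y \<circ> f\<close> and all \<open>q \<circ> f\<close> from \<open>B\<close> to maps \<open>e \<tau>\<close>,
  \<open>e y\<close>, \<open>e q\<close> on \<open>Z\<close>. Where \<open>e \<tau> z > 0\<close> these determine a point \<open>x = e y z / m z\<close> of the disc, with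
  \<open>m = e \<tau>\<close> on \<open>B\<close>, whose distance \<open>\<delta> z x\<close> from the remaining extended coordinates vanishes on \<open>B\<close>.
  As \<open>\<delta>\<close> grows from \<open>0\<close> to \<open>e \<tau> z\<close>, the point \<open>x\<close> is pushed radially to the sphere, so that on the
  rim \<open>\<delta> = e \<tau>\<close> the map takes values in \<open>L\<close> and can be continued by the extension property of \<open>L\<close>.
  The closed relations \<open>T\<close> and \<open>V\<close> encode this without dividing by \<open>e \<tau> z\<close>, which makes the map
  continuous where \<open>e \<tau> z = 0\<close>.
\<close>
lemma nbhd_extensor_attach:
  assumes Z: "compact_space Z" "Hausdorff_space Z"
    and ext: "nbhd_extensor Z K L" and sep: "separating K L Q0"
  shows "nbhd_extensor Z K L'"
  unfolding nbhd_extensor_def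
proof (intro allI impI, elim conjE)
  fix B f
  assume B: "closedin Z B" and f: "continuous_map (subtopology Z B) (subtopology K L') f"

  \<comment> \<open>Coordinates on \<open>L'\<close> and their extensions to
    \<open>Z\<close>\<close>
  obtain Q \<tau> y where Q: "separating K L' Q" and \<tau>: "\<tau> \<in> Q"
    and y: "\<And>i. i < n \<Longrightarrow> continuous_map (subtopology K L') euclideanreal (y i)"
    and \<tau>0: "\<And>k. k \<in> L \<Longrightarrow> \<tau> k = 0"
    and \<tau>\<Phi>: "\<And>x. x \<in> cell_disc n \<Longrightarrow> \<tau> (\<Phi> x) = 1 - radius n x"
    and y\<Phi>: "\<And>x i. x \<in> cell_disc n \<Longrightarrow> i < n \<Longrightarrow> y i (\<Phi> x) = (1 - radius n x) * x i"
    using separating_attach[OF sep] by metis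
  have finQ: "finite Q" and Qc: "\<And>q. q \<in> Q \<Longrightarrow> continuous_map (subtopology K L') euclideanreal q"
    and Qsep: "\<And>k k'. k \<in> L' \<Longrightarrow> k' \<in> L' \<Longrightarrow> (\<And>q. q \<in> Q \<Longrightarrow> q k = q k') \<Longrightarrow> k = k'"
    using Q by (auto simp: separating_def)
  have BZ: "B \<subseteq> topspace Z"
    by (rule closedin_subset[OF B])
  have fL': "f b \<in> L'" if "b \<in> B" for b
    using f that BZ by (auto simp: continuous_map_def Pi_iff)
  have L'K: "L' \<subseteq> topspace K" and LL': "L \<subseteq> L'"
    using compactin_subset_topspace[OF compactin_L'] by (auto simp: L'_def)
  have nZ: "normal_space Z"
    using Z compact_Hausdorff_or_regular_imp_normal_space by blast
  \<comment> \<open>Continuity of \<open>q\<close> stands inside the existential so that one choice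
    function \<open>e\<close> serves \<open>\<tau>\<close>, the \<open>y i\<close> and all of
    \<open>Q\<close>.\<close>
  have "\<exists>q'. continuous_map (subtopology K L') euclideanreal q \<longrightarrow>
      continuous_map Z euclideanreal q' \<and> (\<forall>b\<in>B. q' b = q (f b))" for q
    using Tietze_extension_realinterval[OF nZ B, of UNIV "q \<circ> f"] continuous_map_compose[OF f, of euclideanreal q]
    by (metis UNIV_not_empty comp_apply is_interval_univ subset_UNIV)
  then obtain e where e: "\<And>q. continuous_map (subtopology K L') euclideanreal q \<Longrightarrow> continuous_map Z euclideanreal (e q)"
    and eB: "\<And>q b. continuous_map (subtopology K L') euclideanreal q \<Longrightarrow> b \<in> B \<Longrightarrow> e q b = q (f b)"
    by metis
  \<comment> \<open>On \<open>L'\<close> the norm of the vector of the \<open>y i\<close> is at most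
    \<open>\<tau>\<close>, but off \<open>B\<close> the extensions may violate this. The maximum
    keeps the quotient of \<open>e (y i) z\<close> by \<open>m z\<close> in the unit disc.\<close>
  define m where "m z = max (e \<tau> z) (radius n (\<lambda>i. e (y i) z))" for z
  define \<delta> where "\<delta> z x = (\<Sum>q\<in>Q. \<bar>q (\<Phi> x) - e q z\<bar>)" for z x
  define P where "P = prod_topology (disc_top n) (top_of_set {0..1::real})"
  define ZP where "ZP = prod_topology Z P"
  \<comment> \<open>\<open>U\<close> fixes the disc point \<open>x\<close> belonging to
    \<open>z\<close> and leaves \<open>t\<close> free; \<open>T\<close> then makes \<open>t\<close>
    the ratio of \<open>\<delta> z x\<close> to \<open>e \<tau> z\<close>, confined to the unit
    interval.\<close>
  define U where "U = {v \<in> topspace ZP. \<forall>i\<in>{..<n}. m (fst v) * fst (snd v) i = e (y i) (fst v)}"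
  define T where "T = U \<inter> {v \<in> topspace ZP. \<delta> (fst v) (fst (snd v)) = snd (snd v) * e \<tau> (fst v)}"
  have topZP: "topspace ZP = topspace Z \<times> cell_disc n \<times> {0..1}"
    by (simp add: ZP_def P_def)
  have inU: "(z, x, t) \<in> U \<longleftrightarrow> z \<in> topspace Z \<and> x \<in> cell_disc n \<and> 0 \<le> t \<and> t \<le> 1 \<and>
      (\<forall>i<n. m z * x i = e (y i) z)" for z x t
    by (auto simp: U_def topZP)
  have inT: "(z, x, t) \<in> T \<longleftrightarrow> z \<in> topspace Z \<and> x \<in> cell_disc n \<and> 0 \<le> t \<and> t \<le> 1 \<and>
      (\<forall>i<n. m z * x i = e (y i) z) \<and> \<delta> z x = t * e \<tau> z" for z x t
    by (auto simp: T_def inU topZP)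
  have P: "compact_space P"
    by (simp add: P_def compact_space_prod_topology compact_space_disc compact_space_subtopology)
  have c1: "continuous_map ZP Z fst" "continuous_map ZP (disc_top n) (\<lambda>v. fst (snd v))"
    "continuous_map ZP (top_of_set {0..1}) (\<lambda>v. snd (snd v))"
    unfolding ZP_def P_def
    using continuous_map_fst continuous_map_compose[OF continuous_map_snd continuous_map_fst, unfolded o_def]
      continuous_map_compose[OF continuous_map_snd continuous_map_snd, unfolded o_def] by blast+
  have c1': "continuous_map ZP euclideanreal (\<lambda>v. snd (snd v))"
    using c1(3) continuous_map_into_fulltopology by blast
  have c2: "continuous_map ZP euclideanreal (\<lambda>v. g (fst v))" if "continuous_map Z euclideanreal g" for g
    using continuous_map_compose[OF c1(1) that] by (simp add: o_def)
  have c3: "continuous_map ZP euclideanreal (\<lambda>v. fst (snd v) i)" for i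
    using continuous_map_compose[OF c1(2) continuous_map_disc_coord] by (simp add: o_def)
  have \<Phi>': "continuous_map (disc_top n) (subtopology K L') \<Phi>"
    using \<Phi> \<Phi>_in_L' by (auto simp: continuous_map_in_subtopology)
  have c4: "continuous_map ZP euclideanreal (\<lambda>v. q (\<Phi> (fst (snd v))))" if "q \<in> Q" for q
    using continuous_map_compose[OF c1(2) continuous_map_compose[OF \<Phi>' Qc[OF that]]] by (simp add: o_def)
  have cm: "continuous_map Z euclideanreal m"
    unfolding m_def by (intro continuous_intros continuous_map_radius e y Qc \<tau>)
  have c\<delta>: "continuous_map ZP euclideanreal (\<lambda>v. \<delta> (fst v) (fst (snd v)))"
    unfolding \<delta>_def by (intro continuous_intros c4 c2 e Qc finQ)
  have clU: "closedin ZP U"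
    unfolding U_def by (intro closedin_equalizers[where Y = euclideanreal] continuous_intros c2 cm c3 e y) auto
  have clT: "closedin ZP T"
    unfolding T_def by (intro closedin_Int clU closedin_continuous_maps_eq[where Y = euclideanreal]
        continuous_intros c\<delta> c1' c2 e Qc \<tau>) auto
  have clfst: "closedin Z (fst ` S)" if "closedin ZP S" for S
    using Abstract_Topological_Spaces.closed_map_fst[OF P] that unfolding closed_map_def ZP_def by blast
  have m0: "0 \<le> m z" for z
    by (simp add: m_def le_max_iff_disj)
  have \<delta>0: "0 \<le> \<delta> z x" for z x
    by (simp add: \<delta>_def sum_nonneg)
  have \<delta>D: "\<bar>q (\<Phi> x) - e q z\<bar> \<le> \<delta> z x" if "q \<in> Q" for q z x
    unfolding \<delta>_def using member_le_sum[OF that, of "\<lambda>q. \<bar>q (\<Phi> x) - e q z\<bar>"] finQ by simp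
  have uniqx: "x = x'" if "(z, x, t) \<in> U" "(z, x', t') \<in> U" "e \<tau> z > 0" for z x x' t t'
  proof
    fix i show "x i = x' i"
    proof (cases "i < n")
      case True
      then have "m z * x i = m z * x' i"
        using that by (simp add: inU)
      moreover have "m z > 0"
        using that(3) by (simp add: m_def)
      ultimately show ?thesis by simp
    qed (use that in \<open>auto simp: inU cell_radius\<close>)
  qed
  have uniq: "x = x' \<and> t = t'" if "(z, x, t) \<in> T" "(z, x', t') \<in> T" "e \<tau> z > 0" for z x x' t t'
    using uniqx[of z x t x' t'] that by (auto simp: T_def topZP)
  \<comment> \<open>If \<open>e \<tau> z = 0\<close>, then \<open>\<delta> z x = 0\<close>, so every
    coordinate of \<open>\<Phi> x\<close> is prescribed, and \<open>\<tau> (\<Phi> x) = 0\<close>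
    puts \<open>x\<close> on the sphere. Here \<open>x\<close> need not be unique, but
    \<open>\<Phi> x\<close> is.\<close>
  have T0: "radius n x = 1 \<and> \<Phi> x \<in> L \<and> (\<forall>q\<in>Q. q (\<Phi> x) = e q z)" if "(z, x, t) \<in> T" "e \<tau> z = 0" for z x t
  proof -
    have "\<delta> z x = 0" and x: "x \<in> cell_disc n"
      using that by (auto simp: inT)
    then have q: "q (\<Phi> x) = e q z" if "q \<in> Q" for q
      using \<delta>D[OF that, of x z] by simp
    then have "radius n x = 1"
      using \<tau>\<Phi>[OF x] that(2) \<tau> by fastforce
    then show ?thesis
      using q \<Phi>_in_L x by blast
  qed
  \<comment> \<open>A negative \<open>e \<tau> z\<close> would force
    \<open>\<delta> z x \<le> 0\<close> and thus equal \<open>\<tau> (\<Phi> x)\<close>, which is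
    nonnegative.\<close>
  have Tpos: "0 \<le> e \<tau> z" if "(z, x, t) \<in> T" for z x t
  proof (rule ccontr)
    assume *: "\<not> 0 \<le> e \<tau> z"
    then have "t * e \<tau> z \<le> 0"
      using that by (simp add: inT mult_nonneg_nonpos)
    then have "\<delta> z x \<le> 0" and x: "x \<in> cell_disc n"
      using that by (simp_all add: inT)
    then have "\<tau> (\<Phi> x) = e \<tau> z"
      using \<delta>D[OF \<tau>, of x z] by simp
    then show False
      using * \<tau>\<Phi>[OF x] x by (simp add: cell_radius)
  qed

  \<comment> \<open>The pushed map on the projection of \<open>T\<close>\<close>
  define h where "h = (\<lambda>v :: 'a \<times> (nat \<Rightarrow> real) \<times> real. \<Phi> (push n (snd (snd v)) (fst (snd v))))"
  have h: "continuous_map (subtopology ZP T) K h"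
  proof -
    have "continuous_map ZP (disc_top n) (\<lambda>v. push n (snd (snd v)) (fst (snd v)))"
      by (rule continuous_map_push) (use c1 c1' in \<open>auto simp: topZP\<close>)
    from continuous_map_compose[OF this \<Phi>] show ?thesis
      by (simp add: h_def o_def continuous_map_from_subtopology)
  qed
  have hT0: "h (z, x, t) = \<Phi> x" if "(z, x, t) \<in> T" "e \<tau> z = 0" for z x t
    using T0[OF that] that(1) push_sphere[of x n t] by (simp add: h_def inT cell_radius)
  have single: "h (z, p) = h (z, p')" if zp: "(z, p) \<in> T" "(z, p') \<in> T" for z p p'
  proof -
    obtain x t x' t' where p: "p = (x, t)" "p' = (x', t')"
      by (metis prod.exhaust)
    consider "e \<tau> z > 0" | "e \<tau> z = 0"
      using Tpos[of z x t] zp p by force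
    then show ?thesis
    proof cases
      case 1
      then show ?thesis
        using uniq[of z x t x' t'] zp p by simp
    next
      case 2
      have "\<Phi> x = \<Phi> x'"
        using T0[of z x t] T0[of z x' t'] zp p 2 LL' by (intro Qsep) (auto simp: subset_iff)
      then show ?thesis
        using hT0[of z x t] hT0[of z x' t'] zp p 2 by simp
    qed
  qed
  obtain G1 where G1: "closedin Z (fst ` T)" "continuous_map (subtopology Z (fst ` T)) K G1"
    "\<And>z p. (z, p) \<in> T \<Longrightarrow> G1 z = h (z, p)"
    using continuous_map_of_closed_relation[OF P clT[unfolded ZP_def] h[unfolded ZP_def] single] by blast

  \<comment> \<open>The map with values in \<open>L\<close>, and gluing\<close>
  define ZL where "ZL = prod_topology Z (subtopology K L)"
  \<comment> \<open>A value \<open>f b\<close> in \<open>L\<close> need not come from the disc, so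
    \<open>T\<close> may miss \<open>b\<close>; \<open>V\<close> supplies these points.\<close>
  define V where "V = {v \<in> topspace ZL. \<forall>q\<in>Q. e q (fst v) = q (snd v)}"
  have LK: "L \<subseteq> topspace K"
    using L'K LL' by blast
  have inV: "(z, k) \<in> V \<longleftrightarrow> z \<in> topspace Z \<and> k \<in> L \<and> (\<forall>q\<in>Q. e q z = q k)" for z k
    using LK by (auto simp: V_def ZL_def)
  have clV: "closedin ZL V"
    unfolding V_def
  proof (rule closedin_equalizers[where Y = euclideanreal])
    fix q assume q: "q \<in> Q"
    show "continuous_map ZL euclideanreal (\<lambda>v. e q (fst v))"
      using continuous_map_compose[OF continuous_map_fst e[OF Qc[OF q]]] by (simp add: o_def ZL_def)
    have "continuous_map (subtopology K L) euclideanreal q"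
      using Qc[OF q] LL' continuous_map_from_subtopology_mono by blast
    from continuous_map_compose[OF continuous_map_snd this]
    show "continuous_map ZL euclideanreal (\<lambda>v. q (snd v))"
      by (simp add: o_def ZL_def)
  qed auto
  have hV: "continuous_map (subtopology ZL V) K snd"
    using continuous_map_into_fulltopology[OF continuous_map_snd] by (auto simp: ZL_def intro: continuous_map_from_subtopology)
  obtain G2 where G2: "closedin Z (fst ` V)" "continuous_map (subtopology Z (fst ` V)) K G2"
    "\<And>z k. (z, k) \<in> V \<Longrightarrow> G2 z = snd (z, k)"
  proof (rule continuous_map_of_closed_relation[OF _ clV[unfolded ZL_def] hV[unfolded ZL_def]])
    show "compact_space (subtopology K L)"
      using L by (simp add: compact_space_subtopology)
    show "snd (z, k) = snd (z, k')" if "(z, k) \<in> V" "(z, k') \<in> V" for z k k'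
      using that LL' by (auto simp: inV intro!: Qsep)
  qed blast
  \<comment> \<open>Since \<open>\<tau>\<close> vanishes on \<open>L\<close>, the two sets overlap
    only where \<open>e \<tau> z = 0\<close>. There both maps give the unique point of
    \<open>L\<close> with coordinates \<open>e q z\<close>.\<close>
  have VT: "G1 z = k" if zk: "(z, k) \<in> V" "z \<in> fst ` T" for z k
  proof -
    obtain x t where T: "(z, x, t) \<in> T"
      using zk(2) by force
    have z0: "e \<tau> z = 0"
      using zk \<tau> \<tau>0 by (auto simp: inV)
    have "\<Phi> x = k"
      using T0[OF T z0] zk LL' by (intro Qsep) (auto simp: inV)
    then show ?thesis
      using G1(3)[OF T] hT0[OF T z0] by simp
  qed
  define C where "C = fst ` T \<union> fst ` V"
  define G where "G z = (if z \<in> fst ` T then G1 z else G2 z)" for z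
  have clC: "closedin Z C"
    using G1 G2 by (simp add: C_def closedin_Un)
  have GT: "G z = h (z, p)" if "(z, p) \<in> T" for z p
    using G1(3)[OF that] imageI[OF that, of fst] by (simp add: G_def)
  have GV: "G z = k" if "(z, k) \<in> V" for z k
    using VT[OF that] G2(3)[OF that] by (simp add: G_def)
  have hL': "h (z, x, t) \<in> L'" if "(z, x, t) \<in> T" for z x t
    using that push_in_disc by (auto simp: h_def inT intro!: \<Phi>_in_L')
  have GL': "G z \<in> L'" if "z \<in> C" for z
    using that GT GV hL' LL' inV by (fastforce simp: C_def)
  have contG: "continuous_map (subtopology Z C) (subtopology K L') G"
  proof -
    have "continuous_map (subtopology Z C) K G"
      unfolding C_def G_def
      using VT G2(3) by (intro continuous_map_closed_Un G1 G2) force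
    then show ?thesis
      using GL' by (auto simp: continuous_map_in_subtopology)
  qed
  \<comment> \<open>On \<open>B\<close> the extensions have their original values, so
    \<open>\<delta> b x = 0\<close> and the parameter 0 is admissible, at which \<open>push\<close>
    is the identity.\<close>
  have fT: "(b, x, 0) \<in> T \<and> G b = f b" if b: "b \<in> B" and x: "x \<in> cell_disc n" "f b = \<Phi> x" for b x
  proof -
    have eb: "e \<tau> b = 1 - radius n x" "\<And>i. i < n \<Longrightarrow> e (y i) b = (1 - radius n x) * x i"
      using eB[OF Qc[OF \<tau>] b] eB[OF y b] \<tau>\<Phi> y\<Phi> x by auto
    have "radius n (\<lambda>i. e (y i) b) = radius n (\<lambda>i. (1 - radius n x) * x i)"
      by (rule radius_cong) (rule eb)
    also have "\<dots> = (1 - radius n x) * radius n x"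
      using x by (simp add: radius_scale cell_radius)
    also have "\<dots> \<le> 1 - radius n x"
      using x by (simp add: cell_radius mult_left_le)
    finally have "m b = 1 - radius n x"
      by (simp add: m_def eb)
    moreover have "\<delta> b x = 0"
      using eB[OF Qc _] b x by (simp add: \<delta>_def)
    ultimately have "(b, x, 0) \<in> T"
      using b BZ x eb by (auto simp: inT)
    then show ?thesis
      using GT x push_0 by (simp add: h_def)
  qed
  have fV: "(b, f b) \<in> V" if "b \<in> B" "f b \<in> L" for b
    using that eB[OF Qc] BZ by (auto simp: inV)
  have Gf: "b \<in> C \<and> G b = f b" if b: "b \<in> B" for b
  proof (cases "f b \<in> L")
    case True
    then show ?thesis
      using fV[OF b] GV by (force simp: C_def)
  next
    case False
    then obtain x where "x \<in> cell_disc n" "f b = \<Phi> x"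
      using fL'[OF b] by (auto simp: L'_def)
    then show ?thesis
      using fT[OF b] by (force simp: C_def)
  qed

  \<comment> \<open>The rim and the continuation from \<open>S\<close>\<close>
  define rim where "rim I = T \<inter> {v \<in> topspace ZP. snd (snd v) = 1} \<inter> {v \<in> topspace ZP. radius n (fst (snd v)) \<in> I}" for I
  have clrim: "closedin Z (fst ` rim I)" if "closed I" for I
    unfolding rim_def
    by (intro clfst closedin_Int clT closedin_continuous_maps_eq[where Y = euclideanreal]
        closedin_continuous_map_preimage[where Y = euclideanreal] c1' continuous_map_radius c3)
      (use that in auto)
  have inrim: "(z, x, t) \<in> rim I \<longleftrightarrow> (z, x, t) \<in> T \<and> t = 1 \<and> radius n x \<in> I" for z x t I
    using inT by (auto simp: rim_def topZP)
  \<comment> \<open>At \<open>t = 1\<close> the expansion factor is 5, so radii of at least 1/4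
    reach the sphere and \<open>G\<close> takes values in \<open>L\<close> on \<open>S\<close>. For
    smaller radii \<open>G\<close> may leave \<open>L\<close>; these rim points form
    \<open>D\<close>, which a neighbourhood of \<open>B\<close> will avoid.\<close>
  define S where "S = fst ` rim {1/4..} \<union> fst ` V"
  define D where "D = fst ` rim {..1/4}"
  have clS: "closedin Z S" and clD: "closedin Z D"
    using clrim G2(1) by (auto simp: S_def D_def)
  have SC: "S \<subseteq> C"
    by (force simp: S_def C_def rim_def)
  have GS: "G z \<in> L" if zS: "z \<in> S" for z
  proof (cases "z \<in> fst ` V")
    case True
    then obtain k where "(z, k) \<in> V"
      by auto
    then show ?thesis
      using GV[of z k] inV[of z k] by simp
  next
    case False
    then obtain x where x: "(z, x, 1) \<in> T" "1/4 \<le> radius n x"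
      using zS by (force simp: S_def inrim)
    then have "push n 1 x \<in> cell_sphere n"
      by (intro push_1) (auto simp: inT)
    then show ?thesis
      using GT[OF x(1)] sphere by (auto simp: h_def)
  qed
  have GcL: "continuous_map (subtopology Z S) (subtopology K L) G"
    using continuous_map_from_subtopology_mono[OF contG SC] GS by (auto simp: continuous_map_in_subtopology)
  obtain N R where N: "closedin Z N" "S \<subseteq> Z interior_of N"
    "continuous_map (subtopology Z N) (subtopology K L) R" "\<And>z. z \<in> S \<Longrightarrow> R z = G z"
    using ext[unfolded nbhd_extensor_def, rule_format, OF conjI[OF clS GcL]] by auto
  \<comment> \<open>A point of \<open>B\<close> in \<open>D\<close> has
    \<open>e \<tau> b > 0\<close>, since \<open>e \<tau> b = 0\<close> would give radius 1. Then its
    parameter is 1 on the rim but 0 by \<open>fT\<close>, against uniqueness.\<close>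
  have BD: "B \<inter> D = {}"
  proof (rule ccontr)
    assume "B \<inter> D \<noteq> {}"
    then obtain b x where b: "b \<in> B" and x: "(b, x, 1) \<in> T" "radius n x \<le> 1/4"
      by (force simp: D_def inrim)
    have "e \<tau> b \<noteq> 0"
      using T0[OF x(1)] x(2) by force
    then have "e \<tau> b > 0"
      using Tpos[OF x(1)] by simp
    moreover have "f b \<notin> L"
      using \<open>e \<tau> b \<noteq> 0\<close> eB[OF Qc[OF \<tau>] b] \<tau>0 by auto
    then obtain x' where "x' \<in> cell_disc n" "f b = \<Phi> x'"
      using fL'[OF b] by (auto simp: L'_def)
    then have "(b, x', 0) \<in> T"
      using fT[OF b] by blast
    ultimately show False
      using uniq[OF x(1)] by fastforce
  qed
  then obtain M where M: "closedin Z M" "B \<subseteq> Z interior_of M" "M \<inter> D = {}"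
    using Hausdorff_closed_nbhd[OF Z B clD] by blast

  \<comment> \<open>The frontier of \<open>C\<close>\<close>
  define C' where "C' = Z closure_of (topspace Z - C)"
  \<comment> \<open>Where \<open>e \<tau> z > 0\<close>, a point outside \<open>C\<close> has a disc
    point with \<open>\<delta> z x\<close> at least \<open>e \<tau> z\<close>. This weak inequality
    is a closed condition, so it persists on \<open>C'\<close>.\<close>
  define W where "W = U \<inter> {v \<in> topspace ZP. 0 \<le> \<delta> (fst v) (fst (snd v)) - e \<tau> (fst v)}"
  have "closedin ZP {v \<in> topspace ZP. \<delta> (fst v) (fst (snd v)) - e \<tau> (fst v) \<in> {0..}}"
    by (intro closedin_continuous_map_preimage[where Y = euclideanreal] continuous_intros c\<delta> c2 e Qc \<tau>) auto
  then have "closedin ZP W"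
    unfolding W_def using clU by (intro closedin_Int) auto
  moreover have "closedin Z {z \<in> topspace Z. e \<tau> z \<in> {..0}}"
    by (intro closedin_continuous_map_preimage[where Y = euclideanreal] e Qc \<tau>) auto
  ultimately have "closedin Z (fst ` W \<union> {z \<in> topspace Z. e \<tau> z \<in> {..0}})"
    using clfst by (intro closedin_Un) auto
  moreover have "topspace Z - C \<subseteq> fst ` W \<union> {z \<in> topspace Z. e \<tau> z \<in> {..0}}"
  proof
    fix z assume z: "z \<in> topspace Z - C"
    show "z \<in> fst ` W \<union> {z \<in> topspace Z. e \<tau> z \<in> {..0}}"
    proof (cases "e \<tau> z \<le> 0")
      case False
      then have mz: "m z > 0" "m z \<ge> radius n (\<lambda>i. e (y i) z)"
        by (auto simp: m_def)
      define x where "x i = (if i < n then 1 / m z * e (y i) z else 0)" for i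
      have "radius n x = radius n (\<lambda>i. 1 / m z * e (y i) z)"
        by (simp add: radius_def x_def)
      also have "\<dots> = radius n (\<lambda>i. e (y i) z) / m z"
        using mz by (simp only: radius_scale) simp
      finally have x: "x \<in> cell_disc n" "\<forall>i<n. m z * x i = e (y i) z"
        using mz by (auto simp: cell_radius x_def)
      have "\<delta> z x \<ge> e \<tau> z"
      proof (rule ccontr)
        assume "\<not> \<delta> z x \<ge> e \<tau> z"
        then have "(z, x, \<delta> z x / e \<tau> z) \<in> T"
          using x z False \<delta>0 by (auto simp: inT divide_simps)
        then show False
          using z by (force simp: C_def)
      qed
      then have "(z, x, 0) \<in> W"
        using x z by (auto simp: W_def inU topZP)
      then show ?thesis
        by force
    qed (use z in auto)
  qed
  ultimately have C'W: "C' \<subseteq> fst ` W \<union> {z \<in> topspace Z. e \<tau> z \<in> {..0}}"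
    unfolding C'_def by (rule closure_of_minimal[rotated])
  \<comment> \<open>For \<open>e \<tau> z > 0\<close>, membership in \<open>C\<close> gives
    \<open>t \<le> 1\<close> and membership in \<open>C'\<close> gives \<open>t \<ge> 1\<close>, so
    the point is on the rim. For \<open>e \<tau> z = 0\<close> it lies over
    \<open>V\<close>.\<close>
  have frontier: "z \<in> S" if z: "z \<in> C" "z \<in> C'" "z \<notin> D" for z
  proof (cases "z \<in> fst ` V")
    case False
    then obtain x t where T: "(z, x, t) \<in> T"
      using z(1) by (force simp: C_def)
    have zZ: "z \<in> topspace Z"
      using T by (simp add: inT)
    have "e \<tau> z \<noteq> 0"
    proof
      assume "e \<tau> z = 0"
      then have "(z, \<Phi> x) \<in> V"
        using T0[OF T] zZ by (auto simp: inV)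
      then show False
        using False by force
    qed
    then have pos: "e \<tau> z > 0"
      using Tpos[OF T] by simp
    then obtain x' t' where W: "(z, x', t') \<in> W"
      using C'W z(2) by force
    then have "x' = x"
      using uniqx[of z x' t' x t] pos T by (simp add: W_def T_def)
    then have "e \<tau> z \<le> t * e \<tau> z"
      using W T by (simp add: W_def inT)
    then have "t = 1"
      using pos T by (auto simp: inT)
    then have "(z, x, t) \<in> rim {1/4..} \<or> (z, x, t) \<in> rim {..1/4}"
      using T by (auto simp: inrim)
    then show ?thesis
      using z(3) by (force simp: S_def D_def)
  qed (simp add: S_def)

  \<comment> \<open>The neighbourhood and the extended map\<close>
  define N1 where "N1 = C \<inter> M"
  define N2 where "N2 = N \<inter> M \<inter> C'"
  \<comment> \<open>\<open>N1\<close> and \<open>N2\<close> meet in points of \<open>C\<close> and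
    \<open>C'\<close> outside \<open>D\<close>, hence inside \<open>S\<close>, where
    \<open>R\<close> agrees with \<open>G\<close>.\<close>
  define g where "g z = (if z \<in> N1 then G z else R z)" for z
  show "\<exists>N g. closedin Z N \<and> B \<subseteq> Z interior_of N \<and>
               continuous_map (subtopology Z N) (subtopology K L') g \<and> (\<forall>x\<in>B. g x = f x)"
  proof (intro exI conjI ballI)
    have cl: "closedin Z N1" "closedin Z N2"
      using clC M N by (auto simp: N1_def N2_def C'_def)
    then show "closedin Z (N1 \<union> N2)"
      by blast
    have R: "continuous_map (subtopology Z N) (subtopology K L') R"
      using N(3) LL' by (auto simp: continuous_map_in_subtopology)
    have "continuous_map (subtopology Z (N1 \<union> N2)) (subtopology K L') g"
      unfolding g_def
    proof (rule continuous_map_closed_Un[OF cl])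
      show "continuous_map (subtopology Z N1) (subtopology K L') G"
        using continuous_map_from_subtopology_mono[OF contG] by (simp add: N1_def)
      show "continuous_map (subtopology Z N2) (subtopology K L') R"
        by (rule continuous_map_from_subtopology_mono[OF R]) (auto simp: N2_def)
      show "G z = R z" if "z \<in> N1" "z \<in> N2" for z
      proof -
        have "z \<in> C" "z \<in> C'" "z \<notin> D"
          using that M(3) by (auto simp: N1_def N2_def)
        then show ?thesis
          using frontier N(4)[of z] by simp
      qed
    qed
    then show "continuous_map (subtopology Z (N1 \<union> N2)) (subtopology K L') g" .
    show "g b = f b" if "b \<in> B" for b
      using Gf[OF that] that M(2) interior_of_subset[of Z M] by (auto simp: g_def N1_def)
    have cover: "topspace Z \<subseteq> C \<union> C'"
      using closure_of_subset[of "topspace Z - C" Z] by (auto simp: C'_def)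
    show "B \<subseteq> Z interior_of (N1 \<union> N2)"
    proof
      fix b assume b: "b \<in> B"
      then have bM: "b \<in> Z interior_of M" and bZ: "b \<in> topspace Z" and bC: "b \<in> C"
        using M BZ Gf by auto
      \<comment> \<open>A point \<open>b\<close> in \<open>C'\<close> lies in \<open>S\<close> and
        so in the interior of \<open>N\<close>; otherwise \<open>C\<close> is already a
        neighbourhood of \<open>b\<close>.\<close>
      show "b \<in> Z interior_of (N1 \<union> N2)"
      proof (cases "b \<in> C'")
        case True
        then have "b \<in> Z interior_of N"
          using frontier bC b BD N(2) by blast
        moreover have "Z interior_of M \<inter> Z interior_of N \<subseteq> N1 \<union> N2"
          using cover interior_of_subset[of Z M] interior_of_subset[of Z N] interior_of_subset_topspace[of Z M]
          by (auto simp: N1_def N2_def)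
        ultimately show ?thesis
          using bM by (meson IntI interior_of_maximal openin_Int openin_interior_of subsetD)
      next
        case False
        have "Z interior_of M \<inter> (topspace Z - C') \<subseteq> N1 \<union> N2"
          using cover interior_of_subset[of Z M] by (auto simp: N1_def)
        moreover have "openin Z (Z interior_of M \<inter> (topspace Z - C'))"
          by (intro openin_Int openin_diff) (auto simp: C'_def)
        ultimately show ?thesis
          using bM bZ False by (meson Diff_iff IntI interior_of_maximal subsetD)
      qed
    qed
  qed
qed

end

section \<open>Finite subcomplexes\<close>

locale cw_structure =
  fixes K :: "'b topology" and E :: "'b set set" and dm :: "'b set \<Rightarrow> nat"
    and \<Phi> :: "'b set \<Rightarrow> (nat \<Rightarrow> real) \<Rightarrow> 'b"
  assumes cw: "CW_structure K E dm \<Phi>"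
begin

lemma Hausdorff: "Hausdorff_space K"
  and cells_cover: "\<Union>E = topspace K"
  and cells_disjoint: "pairwise disjnt E"
  using cw by (simp_all add: CW_structure_def)

lemma char_map: "e \<in> E \<Longrightarrow> continuous_map (disc_top (dm e)) K (\<Phi> e)"
  and char_homeo: "e \<in> E \<Longrightarrow>
    homeomorphic_map (subtopology (Euclidean_space (dm e)) (cell_ball (dm e))) (subtopology K e) (\<Phi> e)"
  using cw by (simp_all add: CW_structure_def)

lemma closure_finite: "e \<in> E \<Longrightarrow>
    \<exists>F. finite F \<and> F \<subseteq> {c \<in> E. dm c < dm e} \<and> \<Phi> e ` cell_sphere (dm e) \<subseteq> \<Union>F"
  using cw unfolding CW_structure_def by (elim conjE) (rule bspec)

lemma weak: "A \<subseteq> topspace K \<Longrightarrow> (\<And>e. e \<in> E \<Longrightarrow> closedin K (A \<inter> K closure_of e)) \<Longrightarrow> closedin K A"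
  using cw unfolding CW_structure_def by (elim conjE) simp

lemma cell_unique: "e \<in> E \<Longrightarrow> c \<in> E \<Longrightarrow> k \<in> e \<Longrightarrow> k \<in> c \<Longrightarrow> e = c"
  using cells_disjoint by (auto simp: pairwise_def disjnt_iff)

lemma char_map_ball: "e \<in> E \<Longrightarrow> \<Phi> e ` cell_ball (dm e) = e"
  and char_map_inj: "e \<in> E \<Longrightarrow> inj_on (\<Phi> e) (cell_ball (dm e))"
proof -
  assume e: "e \<in> E"
  then have "topspace K \<inter> e = e"
    using cells_cover by blast
  moreover have "topspace (Euclidean_space (dm e)) \<inter> cell_ball (dm e) = cell_ball (dm e)"
    by (auto simp: cell_ball_def)
  ultimately show "\<Phi> e ` cell_ball (dm e) = e" "inj_on (\<Phi> e) (cell_ball (dm e))"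
    using homeomorphic_imp_surjective_map[OF char_homeo[OF e]]
      homeomorphic_imp_injective_map[OF char_homeo[OF e]] by simp_all
qed

lemma char_map_disc: "e \<in> E \<Longrightarrow> \<Phi> e ` cell_disc (dm e) = e \<union> \<Phi> e ` cell_sphere (dm e)"
  by (simp add: cell_disc_eq image_Un char_map_ball)

lemma compactin_closed_cell: "e \<in> E \<Longrightarrow> compactin K (\<Phi> e ` cell_disc (dm e))"
  using image_compactin[OF _ char_map] compact_space_disc by (metis compact_space_def topspace_disc)

lemma closure_cell: "e \<in> E \<Longrightarrow> K closure_of e \<subseteq> \<Phi> e ` cell_disc (dm e)"
proof (rule closure_of_minimal)
  assume e: "e \<in> E"
  show "e \<subseteq> \<Phi> e ` cell_disc (dm e)"
    by (simp add: char_map_disc[OF e])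
  show "closedin K (\<Phi> e ` cell_disc (dm e))"
    by (rule compactin_imp_closedin[OF Hausdorff compactin_closed_cell[OF e]])
qed

lemma closure_cell_finite:
  assumes e: "e \<in> E"
  obtains F where "finite F" "F \<subseteq> E" "K closure_of e \<subseteq> \<Union>F"
proof -
  obtain F where F: "finite F" "F \<subseteq> {c \<in> E. dm c < dm e}" "\<Phi> e ` cell_sphere (dm e) \<subseteq> \<Union>F"
    using closure_finite[OF e] by blast
  show ?thesis
  proof
    show "K closure_of e \<subseteq> \<Union>(insert e F)"
    proof
      fix k assume "k \<in> K closure_of e"
      then have "k \<in> e \<union> \<Phi> e ` cell_sphere (dm e)"
        using closure_cell[OF e] char_map_disc[OF e] by blast
      then show "k \<in> \<Union>(insert e F)"
        using F(3) by blast
    qed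
  qed (use F e in auto)
qed

text \<open>Choose one point of \<open>C\<close> in each cell that meets \<open>C\<close>. Every set
  of chosen points meets the closure of each cell in a finite set and is therefore closed in the
  weak topology. An infinite choice would thus have no accumulation point, against
  compactness.\<close>

lemma finite_cells_of_compact:
  assumes C: "compactin K C"
  shows "finite {e \<in> E. e \<inter> C \<noteq> {}}"
proof (rule ccontr)
  let ?M = "{e \<in> E. e \<inter> C \<noteq> {}}"
  assume inf: "infinite ?M"
  have "\<forall>e\<in>?M. \<exists>k. k \<in> e \<inter> C"
    by blast
  from bchoice[OF this] obtain p where p': "\<forall>e\<in>?M. p e \<in> e \<inter> C"
    by (rule exE)
  then have p: "p e \<in> e \<inter> C" if "e \<in> ?M" for e
    using that by (rule bspec)
  have "inj_on p ?M"
  proof (rule inj_onI)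
    fix e c assume ec: "e \<in> ?M" "c \<in> ?M" "p e = p c"
    show "e = c"
      using cell_unique[of e c "p e"] p[OF ec(1)] p[OF ec(2)] ec by simp
  qed
  then have infp: "infinite (p ` ?M)"
    using inf finite_imageD by blast
  have pC: "p ` ?M \<subseteq> C"
    using p by blast
  have CK: "C \<subseteq> topspace K"
    by (rule compactin_subset_topspace[OF C])
  have closed: "closedin K A" if A: "A \<subseteq> p ` ?M" for A
  proof (rule weak)
    show AK: "A \<subseteq> topspace K"
      using A pC CK by blast
    fix e assume "e \<in> E"
    then obtain F where F: "finite F" "F \<subseteq> E" "K closure_of e \<subseteq> \<Union>F"
      using closure_cell_finite by blast
    have "A \<inter> K closure_of e \<subseteq> p ` F"
    proof
      fix k assume k: "k \<in> A \<inter> K closure_of e"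
      then have "k \<in> p ` ?M" "k \<in> \<Union>F"
        using A F(3) by (auto simp only: subset_iff Int_iff)
      then obtain c c' where c: "c \<in> ?M" "k = p c" and c': "c' \<in> F" "k \<in> c'"
        by (elim imageE UnionE)
      have "k \<in> c"
        using p[OF c(1)] c(2) by blast
      then have "c = c'"
        using cell_unique[of c c' k] c c' F(2) by blast
      then show "k \<in> p ` F"
        using c c' by blast
    qed
    then have "finite (A \<inter> K closure_of e)"
      using F(1) finite_subset by blast
    then show "closedin K (A \<inter> K closure_of e)"
      using AK Hausdorff by (meson Hausdorff_imp_t1_space le_infI1 t1_space_closedin_finite)
  qed
  obtain k where k: "k \<in> K derived_set_of (p ` ?M)"
    using compactin_imp_Bolzano_Weierstrass[OF C conjI[OF infp pC]] by blast
  have "closedin K (p ` ?M - {k})"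
    by (rule closed) auto
  then have "openin K (topspace K - (p ` ?M - {k}))"
    by blast
  moreover have "k \<in> topspace K - (p ` ?M - {k})"
    using k derived_set_of_subset_topspace[of K] by blast
  moreover have "\<forall>T. k \<in> T \<and> openin K T \<longrightarrow> (\<exists>y\<noteq>k. y \<in> p ` ?M \<and> y \<in> T)"
    by (rule conjunct2[OF CollectD[OF k[unfolded derived_set_of_def]]])
  ultimately have "\<exists>y\<noteq>k. y \<in> p ` ?M \<and> y \<in> topspace K - (p ` ?M - {k})"
    by (elim allE impE) (rule conjI)
  then show False
    by (elim exE conjE) (simp only: Diff_iff singleton_iff simp_thms)
qed

text \<open>Boundaries of cells are required to stay in the union, instead of the union being
  closed. This writes the union as a finite union of compact closed cells.\<close>

definition finite_subcomplex :: "'b set set \<Rightarrow> bool" where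
  "finite_subcomplex F \<longleftrightarrow> finite F \<and> F \<subseteq> E \<and> (\<forall>e\<in>F. \<Phi> e ` cell_sphere (dm e) \<subseteq> \<Union>F)"

lemma finite_subcomplex_Union:
  assumes "finite G" "\<And>c. c \<in> G \<Longrightarrow> \<exists>F. finite_subcomplex F \<and> c \<in> F"
  shows "\<exists>F. finite_subcomplex F \<and> G \<subseteq> F"
proof -
  obtain f where f: "\<And>c. c \<in> G \<Longrightarrow> finite_subcomplex (f c) \<and> c \<in> f c"
    using assms(2) by metis
  have "finite_subcomplex (\<Union>c\<in>G. f c)"
    unfolding finite_subcomplex_def
  proof (intro conjI ballI)
    show "finite (\<Union>c\<in>G. f c)" "(\<Union>c\<in>G. f c) \<subseteq> E"
      using f assms(1) unfolding finite_subcomplex_def by blast+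
    fix e assume "e \<in> (\<Union>c\<in>G. f c)"
    then obtain c where c: "c \<in> G" "e \<in> f c"
      by blast
    then have "\<Phi> e ` cell_sphere (dm e) \<subseteq> \<Union>(f c)"
      using f by (auto simp: finite_subcomplex_def)
    then show "\<Phi> e ` cell_sphere (dm e) \<subseteq> \<Union>(\<Union>c\<in>G. f c)"
      using c by blast
  qed
  moreover have "G \<subseteq> (\<Union>c\<in>G. f c)"
    using f by blast
  ultimately show ?thesis
    by blast
qed

text \<open>Strong induction on the dimension: the boundary meets only cells from a finite set of
  lower-dimensional ones, each of which lies in a finite subcomplex.\<close>

lemma cell_in_finite_subcomplex:
  assumes "e \<in> E"
  shows "\<exists>F. finite_subcomplex F \<and> e \<in> F"
  using assms
proof (induction "dm e" arbitrary: e rule: less_induct)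
  case less
  obtain G where G: "finite G" "G \<subseteq> {c \<in> E. dm c < dm e}" "\<Phi> e ` cell_sphere (dm e) \<subseteq> \<Union>G"
    using closure_finite[OF less.prems] by blast
  obtain F where F: "finite_subcomplex F" "G \<subseteq> F"
    using finite_subcomplex_Union[OF G(1)] G(2) less.hyps by blast
  have "finite_subcomplex (insert e F)"
    unfolding finite_subcomplex_def
  proof (intro conjI ballI)
    fix c assume "c \<in> insert e F"
    then show "\<Phi> c ` cell_sphere (dm c) \<subseteq> \<Union>(insert e F)"
    proof
      assume "c = e"
      then show ?thesis using G(3) F(2) by blast
    next
      assume "c \<in> F"
      then show ?thesis using F(1) unfolding finite_subcomplex_def by blast
    qed
  qed (use F(1) less.prems in \<open>auto simp: finite_subcomplex_def\<close>)
  then show ?case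
    by blast
qed

lemma compact_in_finite_subcomplex:
  assumes "compactin K C"
  obtains F where "finite_subcomplex F" "C \<subseteq> \<Union>F"
proof -
  obtain F where F: "finite_subcomplex F" "{e \<in> E. e \<inter> C \<noteq> {}} \<subseteq> F"
    using finite_subcomplex_Union[OF finite_cells_of_compact[OF assms]] cell_in_finite_subcomplex
    by (metis (no_types, lifting) mem_Collect_eq)
  have "C \<subseteq> \<Union>{e \<in> E. e \<inter> C \<noteq> {}}"
    using compactin_subset_topspace[OF assms] cells_cover by blast
  then show ?thesis
    using that F by blast
qed

lemma finite_subcomplex_compactin:
  assumes "finite_subcomplex F"
  shows "compactin K (\<Union>F)"
proof -
  have "\<Union>F = (\<Union>e\<in>F. \<Phi> e ` cell_disc (dm e))"
  proof (intro equalityI subsetI)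
    fix k assume "k \<in> \<Union>F"
    then obtain e where "e \<in> F" "k \<in> e"
      by blast
    then show "k \<in> (\<Union>e\<in>F. \<Phi> e ` cell_disc (dm e))"
      using assms char_map_disc[of e] by (auto simp: finite_subcomplex_def)
  next
    fix k assume "k \<in> (\<Union>e\<in>F. \<Phi> e ` cell_disc (dm e))"
    then obtain e where e: "e \<in> F" "k \<in> \<Phi> e ` cell_disc (dm e)"
      by blast
    then have "k \<in> e \<union> \<Phi> e ` cell_sphere (dm e)"
      using assms char_map_disc[of e] by (auto simp: finite_subcomplex_def)
    then show "k \<in> \<Union>F"
      using assms e(1) unfolding finite_subcomplex_def by blast
  qed
  moreover have "compactin K \<dots>"
    using assms compactin_closed_cell by (intro compactin_Union) (auto simp: finite_subcomplex_def)
  ultimately show ?thesis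
    by simp
qed

text \<open>A cell of top dimension is removed and attached again. The separating family is carried
  through the induction because attaching a cell requires one on the smaller complex.\<close>

lemma finite_subcomplex_extensor:
  assumes Z: "compact_space Z" "Hausdorff_space Z" and "finite_subcomplex F"
  shows "nbhd_extensor Z K (\<Union>F) \<and> (\<exists>Q. separating K (\<Union>F) Q)"
  using assms(3)
proof (induction "card F" arbitrary: F)
  case 0
  then have "F = {}"
    by (auto simp: finite_subcomplex_def)
  then show ?case
    using nbhd_extensor_empty by (auto simp: separating_def)
next
  case (Suc m)
  then have fin: "finite F" and FE: "F \<subseteq> E" and "F \<noteq> {}"
    by (auto simp: finite_subcomplex_def)
  then have "Max (dm ` F) \<in> dm ` F"
    by simp
  then obtain e where e: "e \<in> F" "\<And>c. c \<in> F \<Longrightarrow> dm c \<le> dm e"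
    using fin by (metis (no_types, lifting) Max_ge finite_imageI imageE image_eqI)
  have eE: "e \<in> E"
    using e(1) FE by blast
  let ?F = "F - {e}"
  \<comment> \<open>Boundary points of \<open>c\<close> lie in cells of dimension below
    \<open>dm c\<close>, which is at most \<open>dm e\<close>; so removing \<open>e\<close> loses
    none of them.\<close>
  have sph: "\<Phi> c ` cell_sphere (dm c) \<subseteq> \<Union>?F" if c: "c \<in> F" for c
  proof
    fix k assume k: "k \<in> \<Phi> c ` cell_sphere (dm c)"
    have cE: "c \<in> E"
      using c FE by blast
    obtain G where G: "G \<subseteq> {c' \<in> E. dm c' < dm c}" "\<Phi> c ` cell_sphere (dm c) \<subseteq> \<Union>G"
      using closure_finite[OF cE] by blast
    obtain d where d: "d \<in> G" "k \<in> d"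
      using G(2) k by blast
    have "\<Phi> c ` cell_sphere (dm c) \<subseteq> \<Union>F"
      using c Suc.prems by (auto simp: finite_subcomplex_def)
    then obtain d' where d': "d' \<in> F" "k \<in> d'"
      using k by blast
    have "d = d'"
      using cell_unique[of d d' k] d d' G(1) FE by blast
    moreover have "d \<noteq> e"
      using d(1) G(1) e(2)[OF c] by auto
    ultimately show "k \<in> \<Union>?F"
      using d' by blast
  qed
  have F': "finite_subcomplex ?F"
    using fin FE sph unfolding finite_subcomplex_def by blast
  moreover have "m = card ?F"
    using Suc.hyps(2) e(1) fin by simp
  ultimately have IH: "nbhd_extensor Z K (\<Union>?F)" "\<exists>Q. separating K (\<Union>?F) Q"
    using Suc.hyps(1) by blast+
  interpret cell_attachment K "\<Union>?F" "dm e" "\<Phi> e"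
  proof
    show "\<Phi> e ` cell_ball (dm e) \<inter> \<Union>?F = {}"
      using cell_unique eE FE unfolding char_map_ball[OF eE] by blast
    show "\<Phi> e ` cell_sphere (dm e) \<subseteq> \<Union>?F"
      by (rule sph[OF e(1)])
  qed (use Hausdorff finite_subcomplex_compactin[OF F'] char_map[OF eE] char_map_inj[OF eE] in auto)
  have "L' = \<Union>?F \<union> (e \<union> \<Phi> e ` cell_sphere (dm e))"
    by (simp add: L'_def char_map_disc[OF eE])
  also have "\<dots> = \<Union>F"
    using sph[OF e(1)] e(1) by blast
  finally have L': "L' = \<Union>F" .
  show ?case
  proof
    obtain Q where Q: "separating K (\<Union>?F) Q"
      using IH(2) by blast
    show "nbhd_extensor Z K (\<Union>F)"
      using nbhd_extensor_attach[OF Z IH(1) Q] by (simp add: L')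
    show "\<exists>Q. separating K (\<Union>F) Q"
      using separating_attach[OF Q] unfolding L' by metis
  qed
qed

end

section \<open>Maps on the Stone-Cech compactification\<close>

lemma continuous_map_stone_cech_eval:
  assumes "h \<in> unit_maps X"
  shows "continuous_map (stone_cech X) euclideanreal (\<lambda>p. p h)"
proof -
  have "continuous_map (unit_cube X) (top_of_set {0..1}) (\<lambda>p. p h)"
    unfolding unit_cube_def by (rule continuous_map_product_projection[OF assms])
  then show ?thesis
    unfolding stone_cech_def by (metis continuous_map_from_subtopology continuous_map_into_fulltopology)
qed

lemma stone_cech_map_in: "x \<in> topspace X \<Longrightarrow> stone_cech_map X x \<in> topspace (stone_cech X)"
  using continuous_map_stone_cech_map[of X] by (auto simp: continuous_map_def Pi_iff)

lemma stone_cech_map_apply: "h \<in> unit_maps X \<Longrightarrow> stone_cech_map X x h = h x"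
  by (simp add: stone_cech_map_def)

text \<open>
  The closed relation consists of the pairs \<open>(p, c)\<close> with \<open>p h = \<phi> c\<close> whenever \<open>h\<close> extends
  \<open>\<phi> \<circ> f\<close>; Tietze's theorem provides enough such \<open>h\<close> to make it single-valued.
\<close>
lemma compact_map_stone_cech_extension:
  assumes X: "normal_space X" and K: "Hausdorff_space K" and A: "closedin X A"
    and f: "compact_map (subtopology X A) K f"
  obtains B g where "closedin (stone_cech X) B" "stone_cech_map X ` A \<subseteq> B"
    "continuous_map (subtopology (stone_cech X) B) K g"
    "\<And>a. a \<in> A \<Longrightarrow> g (stone_cech_map X a) = f a"
proof -
  have AX: "A \<subseteq> topspace X"
    by (rule closedin_subset[OF A])
  obtain C where C: "compactin K C" and fC: "f ` A \<subseteq> C"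
    and fc: "continuous_map (subtopology X A) K f"
    using f AX by (auto simp: compact_map_def Int_absorb1)
  define P where "P = subtopology K C"
  have CK: "C \<subseteq> topspace K"
    by (rule compactin_subset_topspace[OF C])
  have topP: "topspace P = C"
    using CK by (auto simp: P_def)
  have P: "compact_space P" "Hausdorff_space P"
    using C K by (auto simp: P_def compact_space_subtopology Hausdorff_space_subtopology)
  have fP: "continuous_map (subtopology X A) P f"
    using fc fC AX by (auto simp: P_def continuous_map_in_subtopology)
  define J where "J = {(h, \<phi>). h \<in> unit_maps X \<and> continuous_map P euclideanreal \<phi> \<and> (\<forall>a\<in>A. h a = \<phi> (f a))}"
  define T where "T = {v \<in> topspace (prod_topology (stone_cech X) P). \<forall>j\<in>J. fst v (fst j) = snd j (snd v)}"
  have inT: "(p, c) \<in> T \<longleftrightarrow> p \<in> topspace (stone_cech X) \<and> c \<in> C \<and> (\<forall>(h, \<phi>)\<in>J. p h = \<phi> c)" for p c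
    by (auto simp: T_def topP)
  have T: "closedin (prod_topology (stone_cech X) P) T"
    unfolding T_def
  proof (rule closedin_equalizers[where Y = euclideanreal])
    fix j assume "j \<in> J"
    then have j: "fst j \<in> unit_maps X" "continuous_map P euclideanreal (snd j)"
      by (auto simp: J_def)
    show "continuous_map (prod_topology (stone_cech X) P) euclideanreal (\<lambda>v. fst v (fst j))"
      using continuous_map_compose[OF continuous_map_fst continuous_map_stone_cech_eval[OF j(1)]]
      by (simp add: o_def)
    show "continuous_map (prod_topology (stone_cech X) P) euclideanreal (\<lambda>v. snd j (snd v))"
      using continuous_map_compose[OF continuous_map_snd j(2)] by (simp add: o_def)
  qed auto
  have single: "snd (p, c) = snd (p, c')" if pc: "(p, c) \<in> T" "(p, c') \<in> T" for p c c'
  proof (rule ccontr)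
    assume "snd (p, c) \<noteq> snd (p, c')"
    then have ne: "c \<noteq> c'"
      by simp
    have c: "c \<in> topspace P" "c' \<in> topspace P"
      using pc by (auto simp: inT topP)
    have "completely_regular_space P"
      using P by (simp add: compact_Hausdorff_or_regular_imp_normal_space normal_imp_completely_regular_space)
    moreover have "closedin P {c'}"
      using c P(2) by (simp add: closedin_Hausdorff_singleton)
    ultimately obtain \<phi> where \<phi>: "continuous_map P (top_of_set {0..1::real}) \<phi>" "\<phi> c = 0" "\<phi> ` {c'} \<subseteq> {1}"
      unfolding completely_regular_space_def using c ne by (metis DiffI singletonD)
    have \<phi>': "continuous_map P euclideanreal \<phi>"
      using \<phi>(1) continuous_map_into_fulltopology by blast
    have "continuous_map (subtopology X A) euclideanreal (\<phi> \<circ> f)"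
      using continuous_map_compose[OF fP \<phi>'] .
    moreover have "\<phi> ` C \<subseteq> {0..1}"
      using continuous_map_image_subset_topspace[OF \<phi>(1)] by (simp add: topP)
    then have "(\<phi> \<circ> f) ` A \<subseteq> {0..1}"
      using fC by (auto simp: image_subset_iff)
    ultimately obtain h where h: "continuous_map X euclideanreal h" "\<And>x. x \<in> A \<Longrightarrow> h x = (\<phi> \<circ> f) x"
      "h ` topspace X \<subseteq> {0..1}"
      using Tietze_extension_closed_real_interval[OF X A, of "\<phi> \<circ> f" 0 1] by auto
    \<comment> \<open>Only extensional functions occur as indices of the cube.\<close>
    define h' where "h' = restrict h (topspace X)"
    have "continuous_map X (top_of_set {0..1}) h'"
      using h(1,3) unfolding h'_def continuous_map_in_subtopology
      by (auto intro: continuous_map_eq)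
    then have "h' \<in> unit_maps X"
      by (auto simp: unit_maps_def h'_def)
    then have "(h', \<phi>) \<in> J"
      using \<phi>' h(2) AX by (auto simp: J_def h'_def subset_iff)
    then have "p h' = \<phi> c" "p h' = \<phi> c'"
      using pc by (auto simp: inT)
    then show False
      using \<phi> by simp
  qed
  have cs: "continuous_map (subtopology (prod_topology (stone_cech X) P) T) K snd"
    by (metis P_def continuous_map_into_fulltopology continuous_map_subtopology_snd)
  obtain g where g: "closedin (stone_cech X) (fst ` T)"
    "continuous_map (subtopology (stone_cech X) (fst ` T)) K g"
    "\<And>p c. (p, c) \<in> T \<Longrightarrow> g p = snd (p, c)"
    using continuous_map_of_closed_relation[OF P(1) T cs single] by blast
  have "(stone_cech_map X a, f a) \<in> T" if "a \<in> A" for a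
    using that fC AX stone_cech_map_in[of a X] by (auto simp: inT J_def stone_cech_map_apply)
  then show ?thesis
    using that[OF g(1) _ g(2)] g(3) by (metis (no_types, lifting) fst_conv imageI image_subset_iff snd_conv)
qed

text \<open>With \<open>A\<close> the whole space, the closed set \<open>B\<close> contains the
  dense image of \<open>X\<close> and is therefore all of the compactification.\<close>

lemma compact_map_extends_stone_cech:
  assumes "normal_space X" "Hausdorff_space K" "compact_map X K f"
  obtains g where "continuous_map (stone_cech X) K g"
    "\<And>x. x \<in> topspace X \<Longrightarrow> g (stone_cech_map X x) = f x"
proof -
  obtain B g where B: "closedin (stone_cech X) B" "stone_cech_map X ` topspace X \<subseteq> B"
    and g: "continuous_map (subtopology (stone_cech X) B) K g"
    "\<And>x. x \<in> topspace X \<Longrightarrow> g (stone_cech_map X x) = f x"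
    using compact_map_stone_cech_extension[OF assms(1,2) closedin_topspace] assms(3)
    by (metis subtopology_topspace)
  have "topspace (stone_cech X) \<subseteq> B"
    using closure_of_minimal[OF B(2,1)] by (simp add: dense_stone_cech_map)
  then have "continuous_map (stone_cech X) K g"
    using g(1) closedin_subset[OF B(1)] by (metis subset_antisym subtopology_topspace)
  then show ?thesis
    using that g(2) by blast
qed

lemma compact_map_extension_if_stone_cech:
  assumes X: "normal_space X" and K: "Hausdorff_space K" and ext: "map_extension (stone_cech X) K"
  shows "compact_map_extension X K"
  unfolding compact_map_extension_def
proof (intro allI impI, elim conjE)
  fix A f assume A: "closedin X A" and f: "compact_map (subtopology X A) K f"
  obtain B g where B: "closedin (stone_cech X) B" "stone_cech_map X ` A \<subseteq> B"
    "continuous_map (subtopology (stone_cech X) B) K g"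
    "\<And>a. a \<in> A \<Longrightarrow> g (stone_cech_map X a) = f a"
    using compact_map_stone_cech_extension[OF X K A f] by blast
  obtain G where G: "continuous_map (stone_cech X) K G" "\<And>p. p \<in> B \<Longrightarrow> G p = g p"
    using ext B(1,3) unfolding map_extension_def by blast
  have "compactin K (G ` topspace (stone_cech X))"
    by (rule image_compactin[OF compact_Hausdorff_stone_cech(1)[unfolded compact_space_def] G(1)])
  moreover have "(G \<circ> stone_cech_map X) ` topspace X \<subseteq> G ` topspace (stone_cech X)"
    using stone_cech_map_in by force
  moreover have "continuous_map X K (G \<circ> stone_cech_map X)"
    by (rule continuous_map_compose[OF continuous_map_stone_cech_map G(1)])
  ultimately have "compact_map X K (G \<circ> stone_cech_map X)"
    unfolding compact_map_def by blast
  moreover have "(G \<circ> stone_cech_map X) a = f a" if "a \<in> A" for a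
    using that B(2,4) G(2) by (simp add: image_subset_iff)
  ultimately show "\<exists>g. compact_map X K g \<and> (\<forall>x\<in>A. g x = f x)"
    by blast
qed

lemma (in cw_structure) stone_cech_extension_if_compact_map:
  assumes X: "normal_space X" and ext: "compact_map_extension X K"
  shows "map_extension (stone_cech X) K"
  unfolding map_extension_def
proof (intro allI impI, elim conjE)
  let ?Z = "stone_cech X" and ?\<iota> = "stone_cech_map X"
  fix B f assume B: "closedin ?Z B" and f: "continuous_map (subtopology ?Z B) K f"
  note Z = compact_Hausdorff_stone_cech[of X]
  have BZ: "B \<subseteq> topspace ?Z"
    by (rule closedin_subset[OF B])
  have "compactin (subtopology ?Z B) B"
    using closedin_compact_space[OF Z(1) B] by (simp add: compactin_subtopology)
  then have "compactin K (f ` B)"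
    using image_compactin f by blast
  then obtain F where F: "finite_subcomplex F" "f ` B \<subseteq> \<Union>F"
    using compact_in_finite_subcomplex by blast
  have ne: "nbhd_extensor ?Z K (\<Union>F)"
    using finite_subcomplex_extensor[OF Z F(1)] by blast
  have fF: "continuous_map (subtopology ?Z B) (subtopology K (\<Union>F)) f"
    using f F(2) BZ by (auto simp: continuous_map_in_subtopology)
  obtain N g where N: "closedin ?Z N" "B \<subseteq> ?Z interior_of N"
    "continuous_map (subtopology ?Z N) (subtopology K (\<Union>F)) g" "\<And>z. z \<in> B \<Longrightarrow> g z = f z"
    using ne[unfolded nbhd_extensor_def, rule_format, OF conjI[OF B fF]] by auto
  have NZ: "N \<subseteq> topspace ?Z"
    by (rule closedin_subset[OF N(1)])
  \<comment> \<open>The trace of \<open>N\<close> on \<open>X\<close> is closed, and on it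
    \<open>g\<close> composed with the canonical map is compact because its values lie in the
    compact \<open>\<Union>F\<close>.\<close>
  define A where "A = {x \<in> topspace X. ?\<iota> x \<in> N}"
  have A: "closedin X A"
    unfolding A_def by (rule closedin_continuous_map_preimage[OF continuous_map_stone_cech_map N(1)])
  have "continuous_map (subtopology X A) (subtopology ?Z N) ?\<iota>"
    using continuous_map_from_subtopology[OF continuous_map_stone_cech_map]
    by (auto simp: continuous_map_in_subtopology A_def)
  from continuous_map_compose[OF this N(3)]
  have "compact_map (subtopology X A) K (g \<circ> ?\<iota>)"
    using finite_subcomplex_compactin[OF F(1)] unfolding compact_map_def continuous_map_in_subtopology by blast
  then obtain h where h: "compact_map X K h" "\<And>x. x \<in> A \<Longrightarrow> h x = (g \<circ> ?\<iota>) x"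
    using ext A unfolding compact_map_extension_def by blast
  obtain H where H: "continuous_map ?Z K H" "\<And>x. x \<in> topspace X \<Longrightarrow> H (?\<iota> x) = h x"
    using compact_map_extends_stone_cech[OF X Hausdorff h(1)] by blast
  have g: "continuous_map (subtopology ?Z N) K g"
    using N(3) continuous_map_into_fulltopology by blast
  have "closedin (subtopology ?Z N) {z \<in> topspace (subtopology ?Z N). H z = g z}"
    by (intro closedin_continuous_maps_eq[OF Hausdorff] g continuous_map_from_subtopology H)
  then have cl: "closedin ?Z {z \<in> N. H z = g z}"
    using closedin_trans_full[OF _ N(1)] NZ by (simp add: Int_absorb1)
  \<comment> \<open>\<open>H\<close> and \<open>g\<close> agree on the trace of \<open>X\<close> in
    the interior of \<open>N\<close>. This trace is dense in that open set, so they agree on all of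
    it and in particular on \<open>B\<close>.\<close>
  have "?\<iota> ` topspace X \<inter> ?Z interior_of N \<subseteq> {z \<in> N. H z = g z}"
    using H(2) h(2) interior_of_subset[of ?Z N] by (auto simp: A_def)
  then have "?Z closure_of (?Z interior_of N \<inter> ?\<iota> ` topspace X) \<subseteq> {z \<in> N. H z = g z}"
    using cl by (intro closure_of_minimal) (auto simp: Int_commute)
  moreover have "?Z interior_of N \<subseteq> ?Z closure_of (?Z interior_of N \<inter> ?\<iota> ` topspace X)"
    using openin_Int_closure_of_subset[of ?Z "?Z interior_of N" "?\<iota> ` topspace X"] interior_of_subset_topspace[of ?Z N]
    by (simp add: dense_stone_cech_map Int_absorb2)
  ultimately have "H b = f b" if "b \<in> B" for b
    using that N(2,4) by fastforce
  then show "\<exists>g. continuous_map ?Z K g \<and> (\<forall>x\<in>B. g x = f x)"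
    using H(1) by blast
qed

section \<open>Exhaustions of separable metric spaces\<close>

text \<open>
  \<open>V \<rho>\<close> collects the points having a ball of radius greater than \<open>\<rho>\<close> inside some member \<open>U k\<close> of
  a countable cover with \<open>k < 1 / \<rho>\<close>; the exhausting sets are the closures of the sets \<open>V (1 / (n + 1))\<close>.
\<close>
lemma (in Metric_space) closed_exhaustion:
  assumes sep: "separable_space mtopology"
    and empty: "P {}" and Un: "\<And>S T. P S \<Longrightarrow> P T \<Longrightarrow> P (S \<union> T)"
    and mono: "\<And>S T. P T \<Longrightarrow> S \<subseteq> T \<Longrightarrow> P S"
    and loc: "\<And>x. x \<in> M \<Longrightarrow> \<exists>r>0. P (mball x r)"
  obtains X :: "nat \<Rightarrow> 'a set" where "\<And>n. closedin mtopology (X n)" "\<And>n. P (X n)"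
    "\<And>n. X n \<subseteq> mtopology interior_of (X (Suc n))" "(\<Union>n. X n) = M"
proof (cases "M = {}")
  case True
  then show ?thesis
    using that[of "\<lambda>_. {}"] empty by simp
next
  case False
  define \<epsilon> where "\<epsilon> n = inverse (real (Suc n))" for n
  obtain D where D: "countable D" "D \<subseteq> M" "mtopology closure_of D = M"
    using sep by (auto simp: separable_space_def)
  define I where "I = {i \<in> D \<times> UNIV. P (mball (fst i) (\<epsilon> (snd i)))}"
  have cover: "\<exists>i\<in>I. x \<in> mball (fst i) (\<epsilon> (snd i))" if x: "x \<in> M" for x
  proof -
    obtain r where r: "r > 0" "P (mball x r)"
      using loc[OF x] by blast
    obtain n where n: "\<epsilon> n < r / 2"
      using reals_Archimedean[of "r / 2"] r(1) by (auto simp: \<epsilon>_def)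
    have "\<epsilon> n > 0"
      by (simp add: \<epsilon>_def)
    moreover have "x \<in> mtopology closure_of D"
      using x D(3) by simp
    then have "\<forall>r>0. \<exists>c\<in>D. c \<in> mball x r"
      by (auto simp only: metric_closure_of mem_Collect_eq)
    ultimately obtain c where c: "c \<in> D" "d x c < \<epsilon> n"
      by auto
    then have cM: "c \<in> M"
      using D(2) by blast
    have "mball c (\<epsilon> n) \<subseteq> mball x r"
    proof
      fix y assume "y \<in> mball c (\<epsilon> n)"
      then show "y \<in> mball x r"
        using triangle[OF x cM, of y] c(2) n x by auto
    qed
    then have "(c, n) \<in> I"
      using c(1) r(2) mono by (simp add: I_def)
    moreover have "x \<in> mball c (\<epsilon> n)"
      using c cM x by (simp add: commute)
    ultimately show ?thesis
      by force
  qed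
  have "countable I"
    using D(1) unfolding I_def by (intro countable_Collect countable_SIGMA) auto
  \<comment> \<open>The enumeration by \<open>from_nat_into\<close> needs a nonempty index set,
    hence the separate case of the empty space.\<close>
  moreover have "I \<noteq> {}"
    using cover False by blast
  ultimately have rI: "range (from_nat_into I) = I"
    by (rule range_from_nat_into[rotated])
  define U where "U k = mball (fst (from_nat_into I k)) (\<epsilon> (snd (from_nat_into I k)))" for k
  have PU: "P (U k)" for k
    using rI by (auto simp: U_def I_def)
  have UM: "\<exists>k. x \<in> U k" if "x \<in> M" for x
    using cover[OF that] rI by (metis U_def imageE)
  define V where "V \<rho> = {x \<in> M. \<exists>k r. \<rho> < r \<and> r \<le> \<epsilon> k \<and> mball x r \<subseteq> U k}" for \<rho>
  \<comment> \<open>Moving the centre by at most \<open>s\<close> costs at most \<open>s\<close> of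
    the radius. Openness of \<open>V \<rho>\<close> and the nesting of the closures both rest on
    this.\<close>
  have shift: "y \<in> V (\<rho> - s)" if xy: "x \<in> V \<rho>" "y \<in> M" "d x y \<le> s" for x y \<rho> s
  proof -
    obtain k r where kr: "\<rho> < r" "r \<le> \<epsilon> k" "mball x r \<subseteq> U k" and x: "x \<in> M"
      using xy(1) by (auto simp: V_def)
    have "mball y (r - s) \<subseteq> mball x r"
    proof
      fix z assume "z \<in> mball y (r - s)"
      then show "z \<in> mball x r"
        using triangle[OF x xy(2), of z] xy(3) x by auto
    qed
    moreover have "0 \<le> s"
      using nonneg[of x y] xy(3) by linarith
    ultimately show ?thesis
      unfolding V_def using kr xy(2) by (intro CollectI conjI exI[of _ k] exI[of _ "r - s"]) auto
  qed
  have Vmono: "V \<rho> \<subseteq> V \<rho>'" if "\<rho>' \<le> \<rho>" for \<rho> \<rho>'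
    using that unfolding V_def by (blast intro: le_less_trans)
  have Vopen: "openin mtopology (V \<rho>)" for \<rho>
    unfolding openin_mtopology
  proof (intro conjI allI impI)
    fix x assume "x \<in> V \<rho>"
    then obtain k r where kr: "\<rho> < r" "r \<le> \<epsilon> k" "mball x r \<subseteq> U k" and x: "x \<in> M"
      by (auto simp: V_def)
    \<comment> \<open>The midpoint of \<open>\<rho>\<close> and \<open>r\<close> leaves room to move
      \<open>x\<close> by half their difference.\<close>
    have "x \<in> V ((\<rho> + r) / 2)"
      unfolding V_def using kr x by (intro CollectI conjI exI[of _ k] exI[of _ r]) auto
    from shift[OF this, of _ "(r - \<rho>) / 2"]
    have "mball x ((r - \<rho>) / 2) \<subseteq> V \<rho>"
      by (auto simp: field_simps)
    then show "\<exists>s>0. mball x s \<subseteq> V \<rho>"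
      using kr(1) by (intro exI[of _ "(r - \<rho>) / 2"]) auto
  qed (auto simp: V_def)
  have PV: "P (V (\<epsilon> n))" for n
  proof -
    have "P (\<Union>k<m. U k)" for m
      by (induction m) (simp_all add: empty PU Un lessThan_Suc)
    \<comment> \<open>From \<open>\<epsilon> n < r\<close> and \<open>r \<le> \<epsilon> k\<close>
      follows \<open>k < n\<close>, so finitely many members of the cover suffice.\<close>
    moreover have "V (\<epsilon> n) \<subseteq> (\<Union>k<n. U k)"
    proof
      fix x assume "x \<in> V (\<epsilon> n)"
      then obtain k r where kr: "\<epsilon> n < r" "r \<le> \<epsilon> k" "mball x r \<subseteq> U k" and x: "x \<in> M"
        by (auto simp: V_def)
      have "\<epsilon> n < \<epsilon> k"
        using kr by simp
      then have "k < n"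
        by (simp add: \<epsilon>_def field_simps)
      moreover have "0 < \<epsilon> n"
        by (simp add: \<epsilon>_def)
      then have "x \<in> mball x r"
        using x kr(1) by simp
      ultimately show "x \<in> (\<Union>k<n. U k)"
        using kr(3) by blast
    qed
    ultimately show ?thesis
      using mono by blast
  qed
  have Vcov: "\<exists>n. x \<in> V (\<epsilon> n)" if x: "x \<in> M" for x
  proof -
    obtain k where k: "x \<in> U k"
      using UM[OF x] by blast
    have "openin mtopology (U k)"
      by (simp add: U_def)
    then obtain r where r: "r > 0" "mball x r \<subseteq> U k"
      using k unfolding openin_mtopology by blast
    have "min r (\<epsilon> k) > 0"
      using r by (simp add: \<epsilon>_def)
    then obtain n where "\<epsilon> n < min r (\<epsilon> k)"
      using reals_Archimedean unfolding \<epsilon>_def by blast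
    moreover have "mball x (min r (\<epsilon> k)) \<subseteq> U k"
      using r(2) by auto
    ultimately show ?thesis
      unfolding V_def using x by (intro exI[of _ n] CollectI conjI exI[of _ k] exI[of _ "min r (\<epsilon> k)"]) auto
  qed
  have cl: "mtopology closure_of V (\<epsilon> n) \<subseteq> V (\<epsilon> (Suc n))" for n
  proof
    fix x assume x: "x \<in> mtopology closure_of V (\<epsilon> n)"
    have "\<epsilon> (Suc n) < \<epsilon> n"
      by (simp add: \<epsilon>_def)
    then have "\<epsilon> n - \<epsilon> (Suc n) > 0"
      by simp
    moreover have "\<forall>r>0. \<exists>y\<in>V (\<epsilon> n). y \<in> mball x r"
      using x by (auto simp only: metric_closure_of mem_Collect_eq)
    ultimately obtain y where "y \<in> V (\<epsilon> n)" "y \<in> mball x (\<epsilon> n - \<epsilon> (Suc n))"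
      by blast
    then show "x \<in> V (\<epsilon> (Suc n))"
      using shift[of y "\<epsilon> n" x "\<epsilon> n - \<epsilon> (Suc n)"] by (simp add: commute less_imp_le)
  qed
  show ?thesis
  proof
    fix n
    show "closedin mtopology (mtopology closure_of V (\<epsilon> n))"
      by simp
    show "P (mtopology closure_of V (\<epsilon> n))"
      using mono[OF PV cl] .
    have "V (\<epsilon> (Suc n)) \<subseteq> mtopology interior_of (mtopology closure_of V (\<epsilon> (Suc n)))"
      using Vopen closure_of_subset[of "V (\<epsilon> (Suc n))" mtopology] by (intro interior_of_maximal) (auto simp: V_def)
    then show "mtopology closure_of V (\<epsilon> n) \<subseteq> mtopology interior_of (mtopology closure_of V (\<epsilon> (Suc n)))"
      using cl by blast
  next
    have "V (\<epsilon> n) \<subseteq> mtopology closure_of V (\<epsilon> n)" for n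
      by (intro closure_of_subset) (auto simp: V_def)
    then have "x \<in> (\<Union>n. mtopology closure_of V (\<epsilon> n))" if "x \<in> M" for x
      using Vcov[OF that] by (meson UNIV_I UN_I subsetD)
    moreover have "mtopology closure_of V (\<epsilon> n) \<subseteq> M" for n
      using closure_of_subset_topspace[of mtopology] by simp
    then have "(\<Union>n. mtopology closure_of V (\<epsilon> n)) \<subseteq> M"
      by (intro UN_least)
    ultimately show "(\<Union>n. mtopology closure_of V (\<epsilon> n)) = M"
      by (metis subset_antisym subsetI)
  qed
qed

text \<open>Otherwise there are points \<open>a n\<close> of \<open>A\<close> converging to
  \<open>x\<close> with images in pairwise distinct cells. The sequence with its limit is compact,
  so its image would be a compact set meeting infinitely many cells.\<close>

lemma (in cw_structure) locally_finitely_many_cells: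
  assumes "Metric_space M d"
    and f: "continuous_map (subtopology (Metric_space.mtopology M d) A) K f"
    and x: "x \<in> M" and A: "closedin (Metric_space.mtopology M d) A"
  shows "\<exists>r>0. \<exists>F. finite F \<and> F \<subseteq> E \<and> f ` (A \<inter> Metric_space.mball M d x r) \<subseteq> \<Union>F"
proof (rule ccontr)
  interpret Metric_space M d by fact
  assume "\<not> ?thesis"
  then have neg: "\<not> f ` (A \<inter> mball x r) \<subseteq> \<Union>F" if "r > 0" "finite F" "F \<subseteq> E" for r F
    using that by blast
  have AM: "A \<subseteq> M"
    using closedin_subset[OF A] by simp
  \<comment> \<open>If \<open>x\<close> is outside the closed set \<open>A\<close>, some ball misses
    \<open>A\<close> and the empty family of cells would do.\<close>
  have xA: "x \<in> A"
  proof (rule ccontr)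
    assume "x \<notin> A"
    moreover have "openin mtopology (M - A)"
      using openin_diff[OF openin_topspace A] by simp
    ultimately obtain r where "r > 0" "mball x r \<subseteq> M - A"
      using x unfolding openin_mtopology by blast
    then show False
      using neg[of r "{}"] by auto
  qed
  define \<epsilon> where "\<epsilon> n = inverse (real (Suc n))" for n
  define S where "S n = {e \<in> E. e \<inter> f ` (A \<inter> mball x (\<epsilon> n)) \<noteq> {}}" for n
  have infS: "infinite (S n)" for n
  proof
    assume "finite (S n)"
    moreover have "f ` A \<subseteq> \<Union>E"
      using continuous_map_image_subset_topspace[OF f] AM cells_cover by (simp add: Int_absorb1)
    then have "f ` (A \<inter> mball x (\<epsilon> n)) \<subseteq> \<Union>(S n)"
      unfolding S_def by blast
    ultimately show False
      using neg[of "\<epsilon> n" "S n"] by (auto simp: \<epsilon>_def S_def)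
  qed
  \<comment> \<open>Each \<open>S n\<close> is infinite, so a cell different from all earlier
    choices is always available.\<close>
  have "\<exists>c. \<forall>n::nat. c n \<in> S n \<and> c n \<notin> c ` {..<n}"
  proof (rule dependent_wellorder_choice)
    fix n :: nat and c
    have "\<not> S n \<subseteq> c ` {..<n}"
      using infS finite_subset by blast
    then show "\<exists>r. r \<in> S n \<and> r \<notin> c ` {..<n}"
      by blast
  qed auto
  then obtain c where c: "\<And>n. c n \<in> S n" "\<And>n. c n \<notin> c ` {..<n}"
    by blast
  have "inj c"
    by (rule linorder_injI) (metis c(2) imageI lessThan_iff)
  have "\<exists>a. a \<in> A \<and> a \<in> mball x (\<epsilon> n) \<and> f a \<in> c n" for n
    using c(1)[of n] unfolding S_def by blast
  then obtain a where a: "\<And>n. a n \<in> A" "\<And>n. a n \<in> mball x (\<epsilon> n)" "\<And>n. f (a n) \<in> c n"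
    by metis
  have "limitin mtopology a x sequentially"
    unfolding limitin_metric
  proof (intro conjI allI impI)
    fix r :: real assume "r > 0"
    then obtain n where n: "\<epsilon> n < r"
      using reals_Archimedean unfolding \<epsilon>_def by blast
    have "a m \<in> M \<and> d (a m) x < r" if "m \<ge> n" for m
    proof -
      have "\<epsilon> m \<le> \<epsilon> n"
        using that by (simp add: \<epsilon>_def field_simps)
      then show ?thesis
        using a(2)[of m] n by (simp add: commute)
    qed
    then show "\<forall>\<^sub>F m in sequentially. a m \<in> M \<and> d (a m) x < r"
      using eventually_sequentially by blast
  qed (rule x)
  then have "compactin mtopology (insert x (range a))"
    by (rule compactin_sequence_with_limit) (use a(1) AM in auto)
  then have "compactin (subtopology mtopology A) (insert x (range a))"
    using a(1) xA by (auto simp: compactin_subtopology)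
  then have "compactin K (f ` insert x (range a))"
    using f by (rule image_compactin)
  then have "finite {e \<in> E. e \<inter> f ` insert x (range a) \<noteq> {}}"
    by (rule finite_cells_of_compact)
  moreover have "range c \<subseteq> {e \<in> E. e \<inter> f ` insert x (range a) \<noteq> {}}"
    using c(1) a(3) unfolding S_def by blast
  ultimately have "finite (range c)"
    by (rule finite_subset[rotated])
  then show False
    using \<open>inj c\<close> finite_imageD infinite_UNIV_nat by blast
qed

lemma (in cw_structure) map_extension_if_compact_map:
  assumes M: "Metric_space M d" and sep: "separable_space (Metric_space.mtopology M d)"
    and ext: "compact_map_extension (Metric_space.mtopology M d) K"
  shows "map_extension (Metric_space.mtopology M d) K"
  unfolding map_extension_def
proof (intro allI impI, elim conjE)
  interpret Metric_space M d by fact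
  fix A f assume A: "closedin mtopology A" and f: "continuous_map (subtopology mtopology A) K f"
  have AM: "A \<subseteq> M"
    using closedin_subset[OF A] by simp
  define P where "P S \<longleftrightarrow> (\<exists>F. finite F \<and> F \<subseteq> E \<and> f ` (A \<inter> S) \<subseteq> \<Union>F)" for S
  obtain X where X: "\<And>n. closedin mtopology (X n)" "\<And>n. P (X n)"
    "\<And>n. X n \<subseteq> mtopology interior_of (X (Suc n))" "(\<Union>n::nat. X n) = M"
  proof (rule closed_exhaustion[OF sep, of P])
    show "P {}"
      by (auto simp: P_def)
    show "P (S \<union> T)" if "P S" "P T" for S T
    proof -
      obtain F G where "finite F" "F \<subseteq> E" "f ` (A \<inter> S) \<subseteq> \<Union>F" "finite G" "G \<subseteq> E" "f ` (A \<inter> T) \<subseteq> \<Union>G"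
        using \<open>P S\<close> \<open>P T\<close> unfolding P_def by blast
      then show ?thesis
        unfolding P_def by (intro exI[of _ "F \<union> G"]) (auto simp: Int_Un_distrib)
    qed
    show "P S" if "P T" "S \<subseteq> T" for S T
      using that unfolding P_def by (meson Int_mono image_mono order_refl order_trans)
    show "\<exists>r>0. P (mball x r)" if "x \<in> M" for x
      unfolding P_def by (rule locally_finitely_many_cells[OF M f that A])
  qed blast
  have Xmono: "X m \<subseteq> X n" if "m \<le> n" for m n
    using that
  proof (induction rule: dec_induct)
    case (step n)
    then show ?case
      using X(3)[of n] interior_of_subset[of mtopology "X (Suc n)"] by blast
  qed simp
  have bounded: "\<exists>C. compactin K C \<and> f ` (A \<inter> X n) \<subseteq> C" for n
  proof -
    obtain F where F: "finite F" "F \<subseteq> E" "f ` (A \<inter> X n) \<subseteq> \<Union>F"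
      using X(2)[of n] unfolding P_def by blast
    obtain F' where "finite_subcomplex F'" "F \<subseteq> F'"
      using finite_subcomplex_Union[OF F(1)] cell_in_finite_subcomplex F(2) by blast
    then show ?thesis
      using finite_subcomplex_compactin F(3) by blast
  qed
  have AX: "closedin mtopology (A \<inter> X n)" for n
    using A X(1) by blast
  have fAX: "continuous_map (subtopology mtopology (A \<inter> X n)) K f" for n
    using f by (rule continuous_map_from_subtopology_mono) auto
  \<comment> \<open>Each \<open>h n\<close> is a compact map on the whole space, but only its values
    on \<open>X n\<close> are kept: \<open>h (Suc n)\<close> extends \<open>h n\<close> on
    \<open>X n\<close> glued with \<open>f\<close> on \<open>A \<inter> X (Suc n)\<close>, whose
    image lies in a union of two compact sets.\<close>
  have "\<exists>h. \<forall>n. (compact_map mtopology K (h n) \<and> (\<forall>x\<in>A \<inter> X n. h n x = f x)) \<and>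
      (\<forall>x\<in>X n. h (Suc n) x = h n x)"
  proof (rule dependent_nat_choice)
    have "compact_map (subtopology mtopology (A \<inter> X 0)) K f"
      using bounded[of 0] fAX closedin_subset[OF AX] unfolding compact_map_def by (auto simp: Int_absorb1)
    then show "\<exists>h. compact_map mtopology K h \<and> (\<forall>x\<in>A \<inter> X 0. h x = f x)"
      using ext AX unfolding compact_map_extension_def by blast
  next
    fix h n assume h: "compact_map mtopology K h \<and> (\<forall>x\<in>A \<inter> X n. h x = f x)"
    obtain C where C: "compactin K C" "f ` (A \<inter> X (Suc n)) \<subseteq> C"
      using bounded by blast
    obtain C' where C': "compactin K C'" "h ` M \<subseteq> C'"
      using h by (auto simp: compact_map_def)
    let ?B = "X n \<union> (A \<inter> X (Suc n))" and ?g = "\<lambda>x. if x \<in> X n then h x else f x"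
    have "continuous_map (subtopology mtopology ?B) K ?g"
    proof (rule continuous_map_closed_Un[OF X(1) AX _ fAX])
      show "continuous_map (subtopology mtopology (X n)) K h"
        using h by (simp add: compact_map_def continuous_map_from_subtopology)
    qed (use h in auto)
    moreover have "compactin K (C \<union> C')"
      using C C' by (simp add: compactin_Un)
    moreover have "?g ` topspace (subtopology mtopology ?B) \<subseteq> C \<union> C'"
      using C(2) C'(2) by auto
    ultimately have g: "compact_map (subtopology mtopology ?B) K ?g"
      unfolding compact_map_def by blast
    have B: "closedin mtopology ?B"
      using X(1) AX by (rule closedin_Un)
    obtain h' where h': "compact_map mtopology K h'" "\<And>x. x \<in> ?B \<Longrightarrow> h' x = ?g x"
      using ext[unfolded compact_map_extension_def, rule_format, OF conjI[OF B g]] by auto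
    have "h' x = f x" if "x \<in> A \<inter> X (Suc n)" for x
      using h'(2)[of x] h that by auto
    moreover have "h' x = h x" if "x \<in> X n" for x
      using h'(2)[of x] that by simp
    ultimately show "\<exists>h'. (compact_map mtopology K h' \<and> (\<forall>x\<in>A \<inter> X (Suc n). h' x = f x)) \<and>
        (\<forall>x\<in>X n. h' x = h x)"
      using h'(1) by blast
  qed
  then obtain h where hc: "\<And>n. continuous_map mtopology K (h n)"
    and hA: "\<And>n x. x \<in> A \<Longrightarrow> x \<in> X n \<Longrightarrow> h n x = f x"
    and hS: "\<And>n x. x \<in> X n \<Longrightarrow> h (Suc n) x = h n x"
    by (auto simp: compact_map_def)
  have hmono: "h n x = h m x" if "m \<le> n" "x \<in> X m" for m n x
    using that(1)
  proof (induction rule: dec_induct)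
    case (step n)
    then show ?case
      using hS[of x n] Xmono[of m n] that(2) by auto
  qed simp
  \<comment> \<open>The least index is merely a choice: by \<open>hmono\<close> every
    \<open>n\<close> with \<open>x \<in> X n\<close> gives the same value.\<close>
  define g where "g x = h (LEAST n. x \<in> X n) x" for x
  have g: "g x = h n x" if "x \<in> X n" for n x
    unfolding g_def using that by (metis LeastI Least_le hmono)
  have "continuous_map mtopology K g"
  \<comment> \<open>The interiors form an open cover because each \<open>X n\<close> lies in the
    interior of \<open>X (Suc n)\<close>.\<close>
  proof (rule pasting_lemma[where I = UNIV and T = "\<lambda>n. mtopology interior_of (X n)" and f = h])
    show "continuous_map (subtopology mtopology (mtopology interior_of X n)) K (h n)" for n
      using hc continuous_map_from_subtopology by blast
    show "h i x = h j x" if "x \<in> topspace mtopology \<inter> mtopology interior_of X i \<inter> mtopology interior_of X j" for i j x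
    proof -
      have "x \<in> X i" "x \<in> X j"
        using that interior_of_subset[of mtopology "X i"] interior_of_subset[of mtopology "X j"]
        by (auto simp only: Int_iff subset_iff)
      then show ?thesis
        using g by metis
    qed
    show "\<exists>j. j \<in> UNIV \<and> x \<in> mtopology interior_of X j \<and> g x = h j x" if x: "x \<in> topspace mtopology" for x
    proof -
      obtain n where "x \<in> X n"
        using x X(4) by auto
      then have "x \<in> mtopology interior_of X (Suc n)"
        using X(3) by blast
      then show ?thesis
        using g[of x "Suc n"] interior_of_subset[of mtopology "X (Suc n)"] by blast
    qed
  qed auto
  moreover have "g x = f x" if x: "x \<in> A" for x
  proof -
    obtain n where "x \<in> X n"
      using x X(4) AM by blast
    then show ?thesis
      using g hA x by simp
  qed
  ultimately show "\<exists>g. continuous_map mtopology K g \<and> (\<forall>x\<in>A. g x = f x)"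
    by blast
qed

theorem proposition1p5:
  fixes M :: "'a set" and d :: "'a \<Rightarrow> 'a \<Rightarrow> real" and K :: "'b topology"
  assumes "Metric_space M d"
    and "separable_space (Metric_space.mtopology M d)"
    and "CW_complex K"
  shows "(compact_map_extension (Metric_space.mtopology M d) K
            \<longleftrightarrow> map_extension (stone_cech (Metric_space.mtopology M d)) K)
       \<and> (compact_map_extension (Metric_space.mtopology M d) K
            \<longrightarrow> map_extension (Metric_space.mtopology M d) K)"
proof -
  obtain E dm \<Phi> where "CW_structure K E dm \<Phi>"
    using assms(3) by (auto simp: CW_complex_def)
  then interpret cw_structure K E dm \<Phi>
    by unfold_locales
  have "normal_space (Metric_space.mtopology M d)"
    using assms(1) by (rule Metric_space.normal_space_mtopology)
  then show ?thesis
    using stone_cech_extension_if_compact_map compact_map_extension_if_stone_cech[OF _ Hausdorff]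
      map_extension_if_compact_map[OF assms(1,2)] by blast
qed

end
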